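(* Let $M^2$ be a meridian surface in $\mathbb{E}^4$ given by the parametrization $z(u,v)=f(u)\,r(v)+g(u)\,e_4$, $u\in I$, $v\in J$, with $g'\neq 0$. Then $M^2$ has pointwise 1-type Gauss map of the second kind if and only if one of the following holds: (i) the curve $c: r=r(v)$ is a circle on $S^2(1)$ and the meridian curve $\alpha: u\mapsto(f(u),g(u))$ is determined by $f(u)=au+a_1$, $g(u)=bu+b_1$, where $a$, $a_1$, $b$, $b_1$ are constants. In this case $M^2$ is a developable ruled surface lying in a 3-dimensional space; (ii) the curve $c$ is a great circle on $S^2(1)$ and the meridian curve $\alpha$ is determined by the solutions of the following differential equation $$\left(\ln\frac{-\sqrt{1-f'^2}\left(f(1-f'^2)(ff'')'+f^2f'f''^2+f'(1-f'^2)^2\right)}{ff'(ff'')'(1-f'^2)+f^2f''^2+(1-f'^2)^2}\right)'=-\frac{f'f''}{1-f'^2}.$$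
   Context: Meridian surface: Let $\{e_1,e_2,e_3,e_4\}$ be the standard orthonormal frame in $\mathbb{E}^4$ and $S^2(1)$ the unit 2-sphere centered at the origin in $\mathbb{E}^3=\mathrm{span}\{e_1,e_2,e_3\}$. Let $c: r=r(v)$, $v\in J$, $J\subset\mathbb{R}$, be a smooth curve on $S^2(1)$ parametrized by arc length. Put $t=r'$ and let $\{t(v),n(v),r(v)\}$ be the orthonormal moving frame along $c$ in $\mathbb{E}^3$ with $r'=t$, $t'=\kappa n-r$, $n'=-\kappa t$; the function $\kappa(v)=\langle t'(v),n(v)\rangle$ is the spherical curvature of $c$ (circles on $S^2(1)$ correspond to constant $\kappa$, great circles to $\kappa=0$). Let $f=f(u)$, $g=g(u)$ be non-zero smooth functions on an interval $I\subset\mathbb{R}$ with $f'(u)^2+g'(u)^2=1$ for all $u\in I$ (so for linear $f=au+a_1$, $g=bu+b_1$ one has $a^2+b^2=1$). The meridian surface $M^2$ is the surface $z(u,v)=f(u)\,r(v)+g(u)\,e_4$, $u\in I$, $v\in J$, with the induced metric $du^2+f(u)^2dv^2$. In (ii), given a solution $f$, the function $g$ is defined by $g'=\sqrt{1-f'^2}$. Gauss map: with $x=z_u$ and $y=z_v/f=t$, which form an orthonormal tangent frame, the Gauss map is $G=x\wedge y$, regarded as a map into the vector space $\wedge^2\mathbb{E}^4\cong\mathbb{E}^6$. Laplacian: $\Delta\phi=-\sum_i\left(\nabla'_{\epsilon_i}\nabla'_{\epsilon_i}\phi-\nabla'_{\nabla_{\epsilon_i}\epsilon_i}\phi\right)$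 for a local orthonormal tangent frame $\{\epsilon_1,\epsilon_2\}$, where $\nabla$ is the Levi-Civita connection of $M^2$ and $\nabla'$ is the flat derivative of the ambient space; it is applied componentwise to vector-valued maps such as $G$. Pointwise 1-type Gauss map: $M^2$ has pointwise 1-type Gauss map if $\Delta G=\lambda(G+C)$ for some non-zero smooth function $\lambda$ on $M^2$ and some constant vector $C\in\wedge^2\mathbb{E}^4$. It is of the first kind if $C=0$ and of the second kind otherwise. A developable ruled surface is a ruled surface with zero Gauss curvature.
   Formalization: In the equivalence, (i) requires a ≠ 0, since for a = 0 the Gauss map is pointwise 1-type of the first kind only; in (ii) ln is taken of the absolute value of the quotient, which must be defined and non-zero, and g' = ±√(1−f'²) with one sign on I. *)

theory Defs
  imports "HOL-Analysis.Analysis"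
begin

section \<open>Smooth maps\<close>

text \<open>For open \<open>S\<close> in a Euclidean space, \<open>Ck_on k \<phi> S\<close> says that \<open>\<phi>\<close> is of class \<open>C\<^sup>k\<close> on \<open>S\<close>.\<close>

primrec Ck_on ::
  "nat \<Rightarrow> ('a::real_normed_vector \<Rightarrow> 'b::real_normed_vector) \<Rightarrow> 'a set \<Rightarrow> bool" where
  "Ck_on 0 \<phi> S \<longleftrightarrow> continuous_on S \<phi>"
| "Ck_on (Suc k) \<phi> S \<longleftrightarrow>
     (\<forall>p\<in>S. \<phi> differentiable at p) \<and> (\<forall>h. Ck_on k (\<lambda>p. frechet_derivative \<phi> (at p) h) S)"

definition smooth_on ::
  "'a::real_normed_vector set \<Rightarrow> ('a \<Rightarrow> 'b::real_normed_vector) \<Rightarrow> bool" where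
  "smooth_on S \<phi> \<longleftrightarrow> (\<forall>k. Ck_on k \<phi> S)"


section \<open>Curves on the unit sphere and meridian surfaces\<close>

abbreviation e4 :: "real^4" where
  "e4 \<equiv> axis 4 1"

definition E3 :: "(real^4) set" where
  "E3 = span {axis 1 1, axis 2 1, axis 3 1}"

definition S2 :: "(real^4) set" where
  "S2 = sphere 0 1 \<inter> E3"

text \<open>A circle on the sphere is the section of the sphere by a plane of \<open>E3\<close>, which is the plane
  \<open>p \<bullet> x = h\<close> at distance \<open>\<bar>h\<bar> / norm p < 1\<close> from the origin; it is a great circle if the plane
  passes through the origin.  A curve, being parametrized over an interval, is called a (great)
  circle if it runs along one, so that arcs of circles are included.\<close>

definition is_circle :: "real set \<Rightarrow> (real \<Rightarrow> real^4) \<Rightarrow> bool" where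
  "is_circle J r \<longleftrightarrow>
     (\<exists>p\<in>E3. \<exists>h. p \<noteq> 0 \<and> \<bar>h\<bar> < norm p \<and> r ` J \<subseteq> {x \<in> S2. p \<bullet> x = h})"

definition is_great_circle :: "real set \<Rightarrow> (real \<Rightarrow> real^4) \<Rightarrow> bool" where
  "is_great_circle J r \<longleftrightarrow> (\<exists>p\<in>E3. p \<noteq> 0 \<and> r ` J \<subseteq> {x \<in> S2. p \<bullet> x = 0})"

text \<open>The function \<open>f\<close> has no zeros, as the metric \<open>du\<^sup>2 + f\<^sup>2 dv\<^sup>2\<close> has to be
  nondegenerate; of \<open>g\<close> it is only required that it is not the zero function.\<close>

definition meridian_data ::
  "real set \<Rightarrow> real set \<Rightarrow> (real \<Rightarrow> real) \<Rightarrow> (real \<Rightarrow> real) \<Rightarrow> (real \<Rightarrow> real^4) \<Rightarrow> bool" where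
  "meridian_data I J f g r \<longleftrightarrow>
     open I \<and> is_interval I \<and> I \<noteq> {} \<and>
     open J \<and> is_interval J \<and> J \<noteq> {} \<and>
     smooth_on I f \<and> smooth_on I g \<and>
     (\<forall>u\<in>I. f u \<noteq> 0) \<and> (\<exists>u\<in>I. g u \<noteq> 0) \<and>
     (\<forall>u\<in>I. (deriv f u)\<^sup>2 + (deriv g u)\<^sup>2 = 1) \<and>
     smooth_on J r \<and> r ` J \<subseteq> S2 \<and>
     (\<forall>v\<in>J. norm (vector_derivative r (at v)) = 1)"

definition meridian_surface ::
  "(real \<Rightarrow> real) \<Rightarrow> (real \<Rightarrow> real) \<Rightarrow> (real \<Rightarrow> real^4) \<Rightarrow> real \<times> real \<Rightarrow> real^4" where
  "meridian_surface f g r = (\<lambda>(u, v). f u *\<^sub>R r v + g u *\<^sub>R e4)"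

definition frame_x ::
  "(real \<Rightarrow> real) \<Rightarrow> (real \<Rightarrow> real) \<Rightarrow> (real \<Rightarrow> real^4) \<Rightarrow> real \<times> real \<Rightarrow> real^4" where
  "frame_x f g r = (\<lambda>p. frechet_derivative (meridian_surface f g r) (at p) (1, 0))"

definition frame_y ::
  "(real \<Rightarrow> real) \<Rightarrow> (real \<Rightarrow> real) \<Rightarrow> (real \<Rightarrow> real^4) \<Rightarrow> real \<times> real \<Rightarrow> real^4" where
  "frame_y f g r =
     (\<lambda>p. (1 / f (fst p)) *\<^sub>R frechet_derivative (meridian_surface f g r) (at p) (0, 1))"


section \<open>Differential operators on an immersed surface\<close>

text \<open>A surface is given by an immersion \<open>z\<close> of an open set of parameters \<open>p = (u, v)\<close>; functions on
  the surface and vector fields along it are functions of \<open>p\<close>.  The tangent vector \<open>X p\<close> is the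
  image of a unique parameter vector under the differential of \<open>z\<close>, and the flat derivative of
  \<open>\<phi>\<close> in direction \<open>X\<close> is the derivative of \<open>\<phi>\<close> in the direction of that parameter vector.  In
  what follows, \<open>\<epsilon>1\<close>, \<open>\<epsilon>2\<close> is an orthonormal tangent frame.\<close>

definition flat_deriv ::
  "(real \<times> real \<Rightarrow> real^4) \<Rightarrow> (real \<times> real \<Rightarrow> real^4) \<Rightarrow>
   (real \<times> real \<Rightarrow> 'b::real_normed_vector) \<Rightarrow> real \<times> real \<Rightarrow> 'b" where
  "flat_deriv z X \<phi> p =
     frechet_derivative \<phi> (at p) (THE h. frechet_derivative z (at p) h = X p)"

text \<open>The Levi-Civita connection of the induced metric is the tangential part of the flat
  derivative.\<close>

definition levi_civita ::
  "(real \<times> real \<Rightarrow> real^4) \<Rightarrow> (real \<times> real \<Rightarrow> real^4) \<Rightarrow> (real \<times> real \<Rightarrow> real^4) \<Rightarrow>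
   (real \<times> real \<Rightarrow> real^4) \<Rightarrow> (real \<times> real \<Rightarrow> real^4) \<Rightarrow> real \<times> real \<Rightarrow> real^4" where
  "levi_civita z \<epsilon>1 \<epsilon>2 X Y p =
     (flat_deriv z X Y p \<bullet> \<epsilon>1 p) *\<^sub>R \<epsilon>1 p + (flat_deriv z X Y p \<bullet> \<epsilon>2 p) *\<^sub>R \<epsilon>2 p"

definition laplacian ::
  "(real \<times> real \<Rightarrow> real^4) \<Rightarrow> (real \<times> real \<Rightarrow> real^4) \<Rightarrow> (real \<times> real \<Rightarrow> real^4) \<Rightarrow>
   (real \<times> real \<Rightarrow> 'b::real_normed_vector) \<Rightarrow> real \<times> real \<Rightarrow> 'b" where
  "laplacian z \<epsilon>1 \<epsilon>2 \<phi> p =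
     - (\<Sum>\<epsilon>\<leftarrow>[\<epsilon>1, \<epsilon>2]. flat_deriv z \<epsilon> (flat_deriv z \<epsilon> \<phi>) p
                     - flat_deriv z (levi_civita z \<epsilon>1 \<epsilon>2 \<epsilon> \<epsilon>) \<phi> p)"

text \<open>The Gauss curvature is \<open>R(\<epsilon>1, \<epsilon>2)\<epsilon>2 \<bullet> \<epsilon>1\<close> for the curvature tensor \<open>R\<close> of the Levi-Civita
  connection; as the connection is torsion-free, \<open>B\<close> is the Lie bracket of \<open>\<epsilon>1\<close> and \<open>\<epsilon>2\<close>.\<close>

definition gauss_curvature ::
  "(real \<times> real \<Rightarrow> real^4) \<Rightarrow> (real \<times> real \<Rightarrow> real^4) \<Rightarrow> (real \<times> real \<Rightarrow> real^4) \<Rightarrow>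
   real \<times> real \<Rightarrow> real" where
  "gauss_curvature z \<epsilon>1 \<epsilon>2 p =
     (let D = levi_civita z \<epsilon>1 \<epsilon>2;
          B = (\<lambda>q. D \<epsilon>1 \<epsilon>2 q - D \<epsilon>2 \<epsilon>1 q)
      in (D \<epsilon>1 (D \<epsilon>2 \<epsilon>2) p - D \<epsilon>2 (D \<epsilon>1 \<epsilon>2) p - D B \<epsilon>2 p) \<bullet> \<epsilon>1 p)"

text \<open>A ruled surface is swept out by pieces of straight lines; here the lines are traversed by
  the first parameter.\<close>

definition ruled_surface :: "real set \<Rightarrow> real set \<Rightarrow> (real \<times> real \<Rightarrow> real^4) \<Rightarrow> bool" where
  "ruled_surface I J z \<longleftrightarrow>
     (\<exists>\<beta> w. smooth_on J \<beta> \<and> smooth_on J w \<and> (\<forall>v\<in>J. w v \<noteq> 0) \<and>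
        (\<forall>u\<in>I. \<forall>v\<in>J. z (u, v) = \<beta> v + u *\<^sub>R w v))"

definition developable_ruled_surface ::
  "real set \<Rightarrow> real set \<Rightarrow> (real \<times> real \<Rightarrow> real^4) \<Rightarrow> (real \<times> real \<Rightarrow> real^4) \<Rightarrow>
   (real \<times> real \<Rightarrow> real^4) \<Rightarrow> bool" where
  "developable_ruled_surface I J z \<epsilon>1 \<epsilon>2 \<longleftrightarrow>
     ruled_surface I J z \<and> (\<forall>p \<in> I \<times> J. gauss_curvature z \<epsilon>1 \<epsilon>2 p = 0)"

definition lies_in_3_space :: "(real^4) set \<Rightarrow> bool" where
  "lies_in_3_space M \<longleftrightarrow> (\<exists>A. affine A \<and> aff_dim A = 3 \<and> M \<subseteq> A)"


section \<open>Pointwise 1-type Gauss map\<close>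

text \<open>The space of bivectors is represented by the skew-symmetric matrices, with
  \<open>a \<and> b\<close> being the matrix \<open>a b\<^sup>T - b a\<^sup>T\<close>.\<close>

definition bivectors :: "(real^4^4) set" where
  "bivectors = {A. transpose A = - A}"

definition wedge :: "real^4 \<Rightarrow> real^4 \<Rightarrow> real^4^4" where
  "wedge a b = (\<chi> i j. a $ i * b $ j - b $ i * a $ j)"

definition gauss_map ::
  "(real \<times> real \<Rightarrow> real^4) \<Rightarrow> (real \<times> real \<Rightarrow> real^4) \<Rightarrow> real \<times> real \<Rightarrow> real^4^4" where
  "gauss_map \<epsilon>1 \<epsilon>2 p = wedge (\<epsilon>1 p) (\<epsilon>2 p)"

definition pointwise_1_type ::
  "(real \<times> real) set \<Rightarrow> (real \<times> real \<Rightarrow> real^4) \<Rightarrow> (real \<times> real \<Rightarrow> real^4) \<Rightarrow>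
   (real \<times> real \<Rightarrow> real^4) \<Rightarrow> real^4^4 \<Rightarrow> bool" where
  "pointwise_1_type D z \<epsilon>1 \<epsilon>2 C \<longleftrightarrow>
     (\<exists>l. smooth_on D l \<and> (\<forall>p\<in>D. l p \<noteq> 0) \<and>
        (\<forall>p\<in>D. laplacian z \<epsilon>1 \<epsilon>2 (gauss_map \<epsilon>1 \<epsilon>2) p = l p *\<^sub>R (gauss_map \<epsilon>1 \<epsilon>2 p + C)))"

definition pointwise_1_type_second_kind ::
  "(real \<times> real) set \<Rightarrow> (real \<times> real \<Rightarrow> real^4) \<Rightarrow> (real \<times> real \<Rightarrow> real^4) \<Rightarrow>
   (real \<times> real \<Rightarrow> real^4) \<Rightarrow> bool" where
  "pointwise_1_type_second_kind D z \<epsilon>1 \<epsilon>2 \<longleftrightarrow>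
     (\<exists>C\<in>bivectors. C \<noteq> 0 \<and> pointwise_1_type D z \<epsilon>1 \<epsilon>2 C)"


section \<open>The meridian curves\<close>

text \<open>For \<open>a = 0\<close> and \<open>c\<close> a circle, the surface is a cylinder over a circle and its Gauss map
  satisfies \<open>\<Delta>G = \<lambda>G\<close>, that is, it is pointwise 1-type of the first kind and not of the second.\<close>

definition linear_meridian ::
  "real set \<Rightarrow> (real \<Rightarrow> real) \<Rightarrow> (real \<Rightarrow> real) \<Rightarrow> real \<Rightarrow> real \<Rightarrow> real \<Rightarrow> real \<Rightarrow> bool" where
  "linear_meridian I f g a a1 b b1 \<longleftrightarrow> (\<forall>u\<in>I. f u = a * u + a1 \<and> g u = b * u + b1)"

definition ode_num :: "(real \<Rightarrow> real) \<Rightarrow> real \<Rightarrow> real" where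
  "ode_num f u =
     (let f0 = f u; f1 = deriv f u; f2 = deriv (deriv f) u;
          F = deriv (\<lambda>s. f s * deriv (deriv f) s) u
      in - sqrt (1 - f1\<^sup>2) *
           (f0 * (1 - f1\<^sup>2) * F + f0\<^sup>2 * f1 * f2\<^sup>2 + f1 * (1 - f1\<^sup>2)\<^sup>2))"

definition ode_den :: "(real \<Rightarrow> real) \<Rightarrow> real \<Rightarrow> real" where
  "ode_den f u =
     (let f0 = f u; f1 = deriv f u; f2 = deriv (deriv f) u;
          F = deriv (\<lambda>s. f s * deriv (deriv f) s) u
      in f0 * f1 * F * (1 - f1\<^sup>2) + f0\<^sup>2 * f2\<^sup>2 + (1 - f1\<^sup>2)\<^sup>2)"

text \<open>A solution has to make the quotient under the logarithm defined and nonzero.  The logarithm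
  is that of the absolute value, the antiderivative of the logarithmic derivative: reversing the
  parameter \<open>u\<close> changes the sign of the quotient but not the surface.\<close>

definition ode_solution :: "real set \<Rightarrow> (real \<Rightarrow> real) \<Rightarrow> bool" where
  "ode_solution I f \<longleftrightarrow>
     (\<forall>u\<in>I. ode_den f u \<noteq> 0 \<and> ode_num f u / ode_den f u \<noteq> 0 \<and>
        ((\<lambda>s. ln \<bar>ode_num f s / ode_den f s\<bar>) has_real_derivative
           - (deriv f u * deriv (deriv f) u) / (1 - (deriv f u)\<^sup>2)) (at u))"

text \<open>The meridian curve belonging to a solution \<open>f\<close> has \<open>g' = sqrt (1 - f'\<^sup>2)\<close>, up to the
  reflection of \<open>g\<close>.\<close>

definition ode_meridian :: "real set \<Rightarrow> (real \<Rightarrow> real) \<Rightarrow> (real \<Rightarrow> real) \<Rightarrow> bool" where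
  "ode_meridian I f g \<longleftrightarrow> ode_solution I f \<and>
     (\<exists>\<sigma>\<in>{1, -1}. \<forall>u\<in>I. deriv g u = \<sigma> * sqrt (1 - (deriv f u)\<^sup>2))"

end

theory Submission
  imports Defs
begin

text \<open>
  Over a curve with frame \<open>{r, t, n}\<close> the Gauss map is \<open>G = f' r \<and> t + g' e4 \<and> t\<close>, and its Laplacian
  has no component at \<open>e4 \<and> r\<close>.  If \<open>\<Delta>G = \<lambda>(G + C)\<close> with \<open>\<lambda>\<close> free of zeros, then the constant bivector
  \<open>C\<close> has no such component either.  Differentiating this fact along the curve with the Frenet
  equations, and using \<open>g' \<noteq> 0\<close>, one finds that the spherical curvature \<open>\<kappa>\<close> is a constant \<open>k\<close> and
  that \<open>C = c (r \<and> t + k t \<and> n)\<close> for a number \<open>c \<noteq> 0\<close>; conversely this bivector is constant whenever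
  \<open>\<kappa> = k\<close> is.  So the curve runs along a circle, and the condition on \<open>G\<close> becomes a system of three ordinary
  differential equations along the meridian (\<open>second_kind_imp_gauss_system\<close>,
  \<open>gauss_system_imp_second_kind\<close>).

  If \<open>k \<noteq> 0\<close>, the \<open>t \<and> n\<close> equation determines \<open>\<lambda>\<close> in terms of \<open>f\<close> and \<open>f'\<close>.  Rotating the remaining
  two equations into the directions tangent and normal to the meridian shows that \<open>f\<close> times the
  curvature of the meridian is constant, that \<open>\<lambda> f\<^sup>2\<close> is a positive constant, and hence that \<open>f'\<close> is
  a nonzero constant (\<open>gauss_system_imp_linear\<close>).

  If \<open>k = 0\<close>, the curve is an arc of a great circle and the \<open>t \<and> n\<close> equation is void.  The
  \<open>e4 \<and> t\<close> equation gives \<open>\<lambda>\<close>, the \<open>r \<and> t\<close> equation then gives \<open>c\<close>, and elimination of \<open>g\<close> yields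
  \<open>c sqrt (1 - f'\<^sup>2)\<close> as the quotient under the logarithm of the differential equation, whose
  denominator is \<open>\<lambda> f\<^sup>2 (1 - f'\<^sup>2)\<^sup>2\<close> (\<open>ode_terms\<close>, \<open>ode_quotient\<close>).  The differential equation
  says exactly that \<open>c\<close> is constant, and the nonvanishing conditions on the quotient say that \<open>\<lambda>\<close>
  and \<open>c\<close> have no zeros (\<open>gauss_system_imp_ode\<close>, \<open>ode_imp_gauss_system\<close>).  A line \<open>f = a u + a1\<close> with
  \<open>a \<noteq> 0\<close> solves the system for every \<open>k\<close>, so in the first alternative the circle may be great.

  For a linear meridian the \<open>u\<close>-lines are straight and the Gauss curvature \<open>- f'' / f\<close> vanishes;
  over a circle with pole \<open>p\<close> the functions \<open>p \<bullet> z\<close> and \<open>e4 \<bullet> z\<close> are affine in \<open>u\<close>, which places the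
  surface in a hyperplane.
\<close>

section \<open>Rules for smooth maps\<close>

lemma frechet_derivative_cong_open:
  assumes "open S" "x \<in> S" "\<And>y. y \<in> S \<Longrightarrow> \<phi> y = \<psi> y"
  shows "frechet_derivative \<phi> (at x) = frechet_derivative \<psi> (at x)"
proof -
  have "(\<phi> has_derivative D) (at x) \<longleftrightarrow> (\<psi> has_derivative D) (at x)" for D
    using assms by (metis has_derivative_transform_within_open)
  then show ?thesis
    by (simp add: frechet_derivative_def)
qed

lemma differentiable_cong_open:
  assumes "open S" "x \<in> S" "\<And>y. y \<in> S \<Longrightarrow> \<phi> y = \<psi> y" "\<phi> differentiable at x"
  shows "\<psi> differentiable at x"
  using assms unfolding differentiable_def by (metis has_derivative_transform_within_open)

lemma Ck_on_cong:
  assumes "open S" "\<And>x. x \<in> S \<Longrightarrow> \<phi> x = \<psi> x" "Ck_on k \<phi> S"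
  shows "Ck_on k \<psi> S"
  using assms(2,3)
proof (induction k arbitrary: \<phi> \<psi>)
  case 0
  then show ?case
    by (simp cong: continuous_on_cong)
next
  case (Suc k)
  have "frechet_derivative \<phi> (at x) = frechet_derivative \<psi> (at x)" if "x \<in> S" for x
    using frechet_derivative_cong_open assms(1) Suc.prems(1) that by blast
  then have "Ck_on k (\<lambda>p. frechet_derivative \<psi> (at p) h) S" for h
    using Suc.IH[of "\<lambda>p. frechet_derivative \<phi> (at p) h" "\<lambda>p. frechet_derivative \<psi> (at p) h"]
      Suc.prems by simp
  then show ?case
    using Suc.prems differentiable_cong_open assms(1) by (metis Ck_on.simps(2))
qed

text \<open>Needed for products: the derivative of a product contains the factors themselves, which are
  known to have one more derivative than the induction hypothesis asks for.\<close>

lemma Ck_on_Suc_imp: "Ck_on (Suc k) \<phi> S \<Longrightarrow> Ck_on k \<phi> S"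
proof (induction k arbitrary: \<phi>)
  case 0
  then show ?case
    by (auto intro!: continuous_at_imp_continuous_on differentiable_imp_continuous_within)
next
  case (Suc k)
  then show ?case
    by (metis Ck_on.simps(2))
qed

lemma smooth_on_cong:
  assumes "smooth_on S \<phi>" "open S" "\<And>x. x \<in> S \<Longrightarrow> \<phi> x = \<psi> x"
  shows "smooth_on S \<psi>"
  using assms Ck_on_cong unfolding smooth_on_def by blast

lemma smooth_on_differentiable: "smooth_on S \<phi> \<Longrightarrow> p \<in> S \<Longrightarrow> \<phi> differentiable at p"
  unfolding smooth_on_def by (metis Ck_on.simps(2))

lemma smooth_on_frechet_derivative:
  "smooth_on S \<phi> \<Longrightarrow> smooth_on S (\<lambda>p. frechet_derivative \<phi> (at p) h)"
  unfolding smooth_on_def by (metis Ck_on.simps(2))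

lemma smooth_on_vector_derivative:
  fixes \<phi> :: "real \<Rightarrow> 'b::real_normed_vector"
  assumes "smooth_on S \<phi>" "open S"
  shows "smooth_on S (\<lambda>x. vector_derivative \<phi> (at x))"
    and "x \<in> S \<Longrightarrow> (\<phi> has_vector_derivative vector_derivative \<phi> (at x)) (at x)"
proof -
  have *: "(\<phi> has_vector_derivative vector_derivative \<phi> (at x)) (at x)" if "x \<in> S" for x
    using smooth_on_differentiable[OF assms(1) that] vector_derivative_works by blast
  then show "x \<in> S \<Longrightarrow> (\<phi> has_vector_derivative vector_derivative \<phi> (at x)) (at x)" .
  have "frechet_derivative \<phi> (at x) 1 = vector_derivative \<phi> (at x)" if "x \<in> S" for x
    using frechet_derivative_at[OF *[OF that, unfolded has_vector_derivative_def]]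
    by (metis scaleR_one)
  then show "smooth_on S (\<lambda>x. vector_derivative \<phi> (at x))"
    by (rule smooth_on_cong[OF smooth_on_frechet_derivative[OF assms(1), of 1] assms(2)])
qed

lemma smooth_on_deriv:
  fixes \<phi> :: "real \<Rightarrow> real"
  assumes "smooth_on S \<phi>" "open S"
  shows "smooth_on S (deriv \<phi>)"
    and "x \<in> S \<Longrightarrow> (\<phi> has_real_derivative deriv \<phi> x) (at x)"
proof -
  have *: "(\<phi> has_real_derivative vector_derivative \<phi> (at x)) (at x)" if "x \<in> S" for x
    using smooth_on_vector_derivative(2)[OF assms that]
    by (simp add: has_real_derivative_iff_has_vector_derivative)
  then have "vector_derivative \<phi> (at x) = deriv \<phi> x" if "x \<in> S" for x
    using that DERIV_imp_deriv by metis
  then show "smooth_on S (deriv \<phi>)"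
    and "x \<in> S \<Longrightarrow> (\<phi> has_real_derivative deriv \<phi> x) (at x)"
    using smooth_on_cong[OF smooth_on_vector_derivative(1)[OF assms] assms(2)] * by metis+
qed

lemma Ck_on_const: "Ck_on k (\<lambda>p. c) S"
  by (induction k arbitrary: c) auto

lemma Ck_on_add:
  assumes "open S" "Ck_on k \<phi> S" "Ck_on k \<psi> S"
  shows "Ck_on k (\<lambda>p. \<phi> p + \<psi> p) S"
  using assms(2,3)
proof (induction k arbitrary: \<phi> \<psi>)
  case 0
  then show ?case by (simp add: continuous_on_add)
next
  case (Suc k)
  have D: "((\<lambda>p. \<phi> p + \<psi> p) has_derivative
      (\<lambda>h. frechet_derivative \<phi> (at p) h + frechet_derivative \<psi> (at p) h)) (at p)" if "p \<in> S" for p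
    using Suc.prems that by (auto intro!: derivative_eq_intros simp: frechet_derivative_works)
  have "Ck_on k (\<lambda>p. frechet_derivative (\<lambda>p. \<phi> p + \<psi> p) (at p) h) S" for h
    by (rule Ck_on_cong[OF assms(1) _ Suc.IH[of "\<lambda>p. frechet_derivative \<phi> (at p) h"
            "\<lambda>p. frechet_derivative \<psi> (at p) h"]])
      (use Suc.prems frechet_derivative_at[OF D] in \<open>auto simp: fun_eq_iff\<close>)
  then show ?case
    using D by (auto simp: differentiable_def)
qed

text \<open>One bilinear rule serves multiplication, scaling, the inner product and the cross product.\<close>

lemma Ck_on_bilinear:
  assumes "bounded_bilinear B" "open S" "Ck_on k \<phi> S" "Ck_on k \<psi> S"
  shows "Ck_on k (\<lambda>p. B (\<phi> p) (\<psi> p)) S"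
  using assms(3,4)
proof (induction k arbitrary: \<phi> \<psi>)
  case 0
  then show ?case
    using bounded_bilinear.continuous_on[OF assms(1)] by auto
next
  case (Suc k)
  have D: "((\<lambda>p. B (\<phi> p) (\<psi> p)) has_derivative
      (\<lambda>h. B (\<phi> p) (frechet_derivative \<psi> (at p) h) + B (frechet_derivative \<phi> (at p) h) (\<psi> p)))
      (at p)" if "p \<in> S" for p
    using Suc.prems that
    by (intro bounded_bilinear.FDERIV[OF assms(1)]) (auto simp: frechet_derivative_works)
  have "Ck_on k (\<lambda>p. B (\<phi> p) (frechet_derivative \<psi> (at p) h)
      + B (frechet_derivative \<phi> (at p) h) (\<psi> p)) S" for h
    using Suc.prems Ck_on_Suc_imp[OF Suc.prems(1)] Ck_on_Suc_imp[OF Suc.prems(2)]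
    by (intro Ck_on_add[OF assms(2)] Suc.IH) auto
  then have "Ck_on k (\<lambda>p. frechet_derivative (\<lambda>p. B (\<phi> p) (\<psi> p)) (at p) h) S" for h
    by (rule Ck_on_cong[OF assms(2), rotated])
      (use frechet_derivative_at[OF D] in \<open>auto simp: fun_eq_iff\<close>)
  then show ?case
    using D by (auto simp: differentiable_def)
qed

lemma Ck_on_inverse:
  fixes \<phi> :: "'a::real_normed_vector \<Rightarrow> real"
  assumes "open S" "\<And>p. p \<in> S \<Longrightarrow> \<phi> p \<noteq> 0" "Ck_on k \<phi> S"
  shows "Ck_on k (\<lambda>p. inverse (\<phi> p)) S"
  using assms(3)
proof (induction k)
  case 0
  then show ?case using assms(2) by (auto intro!: continuous_intros)
next
  case (Suc k)
  have D: "((\<lambda>p. inverse (\<phi> p)) has_derivative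
      (\<lambda>h. (- frechet_derivative \<phi> (at p) h) * (inverse (\<phi> p) * inverse (\<phi> p)))) (at p)"
    if "p \<in> S" for p
    using Suc.prems that assms(2)
    by (auto intro!: derivative_eq_intros simp: frechet_derivative_works)
  have I: "Ck_on k (\<lambda>p. inverse (\<phi> p)) S"
    using Suc.IH Ck_on_Suc_imp[OF Suc.prems] by blast
  have "Ck_on k (\<lambda>p. (- 1 * frechet_derivative \<phi> (at p) h) * (inverse (\<phi> p) * inverse (\<phi> p))) S"
    for h
    using Suc.prems I
    by (intro Ck_on_bilinear[OF bounded_bilinear_mult assms(1)] Ck_on_const) auto
  then have "Ck_on k (\<lambda>p. frechet_derivative (\<lambda>p. inverse (\<phi> p)) (at p) h) S" for h
    by (rule Ck_on_cong[OF assms(1), rotated])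
      (use frechet_derivative_at[OF D] in \<open>auto simp: fun_eq_iff\<close>)
  then show ?case
    using D by (auto simp: differentiable_def)
qed

lemma Ck_on_fst:
  fixes a :: "'a::real_normed_vector \<Rightarrow> 'c::real_normed_vector"
    and T :: "'b::real_normed_vector set"
  assumes "open S" "open T" "Ck_on k a S"
  shows "Ck_on k (\<lambda>p. a (fst p)) (S \<times> T)"
  using assms(3)
proof (induction k arbitrary: a)
  case 0
  then show ?case
    by (auto intro!: continuous_on_compose2[of S a] continuous_intros)
next
  case (Suc k)
  have D: "((\<lambda>p. a (fst p)) has_derivative (\<lambda>h. frechet_derivative a (at (fst p)) (fst h))) (at p)"
    if "p \<in> S \<times> T" for p :: "'a \<times> 'b"
    using Suc.prems that
    by (intro has_derivative_compose[OF has_derivative_fst[OF has_derivative_ident]])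
      (auto simp: frechet_derivative_works)
  have C: "Ck_on k (\<lambda>p. frechet_derivative a (at (fst p)) (fst h)) (S \<times> T)" for h :: "'a \<times> 'b"
    using Suc.prems Suc.IH[of "\<lambda>p. frechet_derivative a (at p) (fst h)"] by auto
  have E: "frechet_derivative a (at (fst p)) (fst h) = frechet_derivative (\<lambda>p. a (fst p)) (at p) h"
    if "p \<in> S \<times> T" for p h :: "'a \<times> 'b"
    using frechet_derivative_at[OF D[OF that]] by (rule fun_cong)
  have "Ck_on k (\<lambda>p. frechet_derivative (\<lambda>p. a (fst p)) (at p) h) (S \<times> T)"
    for h :: "'a \<times> 'b"
    by (rule Ck_on_cong[OF open_Times[OF assms(1,2)] E C])
  then show ?case
    using D unfolding Ck_on.simps differentiable_def by blast
qed

lemma smooth_on_const: "smooth_on S (\<lambda>p. c)"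
  by (simp add: smooth_on_def Ck_on_const)

lemma smooth_on_add:
  "open S \<Longrightarrow> smooth_on S \<phi> \<Longrightarrow> smooth_on S \<psi> \<Longrightarrow> smooth_on S (\<lambda>p. \<phi> p + \<psi> p)"
  by (simp add: smooth_on_def Ck_on_add)

lemma smooth_on_bilinear:
  "bounded_bilinear B \<Longrightarrow> open S \<Longrightarrow> smooth_on S \<phi> \<Longrightarrow> smooth_on S \<psi> \<Longrightarrow>
    smooth_on S (\<lambda>p. B (\<phi> p) (\<psi> p))"
  by (simp add: smooth_on_def Ck_on_bilinear)

lemmas smooth_on_mult = smooth_on_bilinear[OF bounded_bilinear_mult]
lemmas smooth_on_scaleR = smooth_on_bilinear[OF bounded_bilinear_scaleR]

lemma smooth_on_divide:
  fixes \<phi> \<psi> :: "'a::real_normed_vector \<Rightarrow> real"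
  assumes "open S" "smooth_on S \<phi>" "smooth_on S \<psi>" "\<And>p. p \<in> S \<Longrightarrow> \<psi> p \<noteq> 0"
  shows "smooth_on S (\<lambda>p. \<phi> p / \<psi> p)"
  unfolding divide_inverse
  using assms smooth_on_mult[OF assms(1,2)] Ck_on_inverse[OF assms(1), of \<psi>]
  by (simp add: smooth_on_def)

lemma smooth_on_diff:
  fixes \<phi> \<psi> :: "'a::real_normed_vector \<Rightarrow> real"
  assumes "open S" "smooth_on S \<phi>" "smooth_on S \<psi>"
  shows "smooth_on S (\<lambda>p. \<phi> p - \<psi> p)"
  using smooth_on_add[OF assms(1,2) smooth_on_mult[OF assms(1) smooth_on_const[of S "-1"] assms(3)]]
  by simp

lemma smooth_on_fst:
  "open S \<Longrightarrow> open T \<Longrightarrow> smooth_on S a \<Longrightarrow> smooth_on (S \<times> T) (\<lambda>p. a (fst p))"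
  by (simp add: smooth_on_def Ck_on_fst)

section \<open>Bivectors and the cross product in a hyperplane\<close>

lemma bounded_bilinear_wedge: "bounded_bilinear wedge"
  unfolding bilinear_conv_bounded_bilinear[symmetric] bilinear_def
  by (auto intro!: linearI simp: wedge_def vec_eq_iff algebra_simps)

lemma wedge_self: "wedge a a = 0"
  by (simp add: wedge_def vec_eq_iff)

text \<open>For a skew matrix \<open>A\<close> and orthonormal \<open>p\<close>, \<open>q\<close> this is the coefficient of \<open>A\<close> at
  \<open>p \<and> q\<close>.  Reading off coefficients in this way avoids choosing a basis of the space of bivectors,
  and the product rule differentiates them along a moving frame.\<close>

definition coeff_on :: "real^4 \<Rightarrow> real^4 \<Rightarrow> real^4^4 \<Rightarrow> real" where
  "coeff_on p q A = p \<bullet> (A *v q)"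

lemma coeff_on_add: "coeff_on p q (A + B) = coeff_on p q A + coeff_on p q B"
  and coeff_on_minus: "coeff_on p q (- A) = - coeff_on p q A"
  and coeff_on_scaleR: "coeff_on p q (c *\<^sub>R A) = c * coeff_on p q A"
proof -
  have [simp]: "(- A) *v q = - (A *v q)"
    by (simp add: matrix_vector_mult_def vec_eq_iff sum_negf)
  show "coeff_on p q (A + B) = coeff_on p q A + coeff_on p q B"
    and "coeff_on p q (- A) = - coeff_on p q A"
    and "coeff_on p q (c *\<^sub>R A) = c * coeff_on p q A"
    by (simp_all add: coeff_on_def matrix_vector_mult_add_rdistrib
        scaleR_matrix_vector_assoc[symmetric] inner_add_right)
qed

lemma coeff_on_wedge:
  "coeff_on p q (wedge a b) = (p \<bullet> a) * (b \<bullet> q) - (p \<bullet> b) * (a \<bullet> q)"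
proof -
  have "wedge a b *v q = (b \<bullet> q) *\<^sub>R a - (a \<bullet> q) *\<^sub>R b"
    by (simp add: vec_eq_iff wedge_def matrix_vector_mult_def inner_vec_def
        left_diff_distrib right_diff_distrib sum_subtractf sum_distrib_left mult_ac)
  then show ?thesis
    by (simp add: coeff_on_def inner_diff_right mult_ac)
qed

lemmas coeff_on_simps =
  coeff_on_add coeff_on_minus coeff_on_scaleR coeff_on_wedge

lemma coeff_on_skew:
  assumes "A \<in> bivectors"
  shows "coeff_on q p A = - coeff_on p q A"
proof -
  have "coeff_on q p A = coeff_on p q (transpose A)"
    unfolding coeff_on_def by (metis dot_lmul_matrix inner_commute transpose_matrix_vector)
  also have "\<dots> = - coeff_on p q A"
    using assms by (simp add: bivectors_def coeff_on_minus)
  finally show ?thesis .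
qed

lemma coeff_on_same: "A \<in> bivectors \<Longrightarrow> coeff_on p p A = 0"
  using coeff_on_skew[of A p p] by simp

lemma bounded_bilinear_coeff_on: "bounded_bilinear (\<lambda>p q. coeff_on p q A)"
  unfolding bilinear_conv_bounded_bilinear[symmetric] bilinear_def
  by (auto intro!: linearI simp: coeff_on_def matrix_vector_right_distrib
      matrix_vector_mult_scaleR inner_add_left inner_add_right)

lemma wedge_in_bivectors: "wedge a b \<in> bivectors"
  by (simp add: bivectors_def wedge_def transpose_def vec_eq_iff)

lemma bivectors_scaleR: "A \<in> bivectors \<Longrightarrow> c *\<^sub>R A \<in> bivectors"
  and bivectors_add: "A \<in> bivectors \<Longrightarrow> B \<in> bivectors \<Longrightarrow> A + B \<in> bivectors"
proof -
  have "transpose (c *\<^sub>R A) = c *\<^sub>R transpose A" "transpose (A + B) = transpose A + transpose B"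
    by (simp_all add: transpose_def vec_eq_iff)
  then show "A \<in> bivectors \<Longrightarrow> c *\<^sub>R A \<in> bivectors"
    and "A \<in> bivectors \<Longrightarrow> B \<in> bivectors \<Longrightarrow> A + B \<in> bivectors"
    by (simp_all add: bivectors_def)
qed

lemma E3_iff: "x \<in> E3 \<longleftrightarrow> x $ 4 = 0"
proof
  assume "x \<in> E3"
  then show "x $ 4 = 0"
    unfolding E3_def by (induction rule: span_induct_alt) (auto simp: axis_def)
next
  assume "x $ 4 = 0"
  then have "x = x $ 1 *\<^sub>R axis 1 1 + x $ 2 *\<^sub>R axis 2 1 + x $ 3 *\<^sub>R axis 3 1"
    by (simp add: vec_eq_iff forall_4 axis_def)
  also have "\<dots> \<in> E3"
    unfolding E3_def by (intro span_add span_scale span_base) auto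
  finally show "x \<in> E3" .
qed

text \<open>The cross product of \<open>\<real>\<^sup>3\<close> applied to the first three coordinates.\<close>

definition crossE :: "real^4 \<Rightarrow> real^4 \<Rightarrow> real^4" where
  "crossE a b = (a $ 2 * b $ 3 - a $ 3 * b $ 2) *\<^sub>R axis 1 1
     + (a $ 3 * b $ 1 - a $ 1 * b $ 3) *\<^sub>R axis 2 1
     + (a $ 1 * b $ 2 - a $ 2 * b $ 1) *\<^sub>R axis 3 1"

lemma crossE_nth:
  "crossE a b $ 1 = a $ 2 * b $ 3 - a $ 3 * b $ 2"
  "crossE a b $ 2 = a $ 3 * b $ 1 - a $ 1 * b $ 3"
  "crossE a b $ 3 = a $ 1 * b $ 2 - a $ 2 * b $ 1"
  "crossE a b $ 4 = 0"
  by (simp_all add: crossE_def axis_def)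

lemma bounded_bilinear_crossE: "bounded_bilinear crossE"
  unfolding bilinear_conv_bounded_bilinear[symmetric] bilinear_def
  by (auto intro!: linearI simp: vec_eq_iff forall_4 crossE_nth algebra_simps)

lemma crossE_orthogonal: "crossE a b \<bullet> a = 0" "crossE a b \<bullet> b = 0"
  by (simp_all add: inner_vec_def sum_4 crossE_nth algebra_simps)

lemma crossE_square:
  assumes "a $ 4 = 0" "b $ 4 = 0"
  shows "crossE a b \<bullet> crossE a b = (a \<bullet> a) * (b \<bullet> b) - (a \<bullet> b)\<^sup>2"
  using assms by (simp add: inner_vec_def sum_4 crossE_nth power2_eq_square algebra_simps)

lemma orthonormal_4_expand:
  fixes a b c d x :: "real^4"
  assumes unit: "a \<bullet> a = 1" "b \<bullet> b = 1" "c \<bullet> c = 1" "d \<bullet> d = 1"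
    and orth: "a \<bullet> b = 0" "a \<bullet> c = 0" "a \<bullet> d = 0" "b \<bullet> c = 0" "b \<bullet> d = 0" "c \<bullet> d = 0"
  shows "x = (x \<bullet> a) *\<^sub>R a + (x \<bullet> b) *\<^sub>R b + (x \<bullet> c) *\<^sub>R c + (x \<bullet> d) *\<^sub>R d"
proof -
  let ?B = "{a, b, c, d}"
  have ne: "a \<noteq> b" "a \<noteq> c" "a \<noteq> d" "b \<noteq> c" "b \<noteq> d" "c \<noteq> d"
    using unit orth by auto
  have po: "pairwise orthogonal ?B"
    using orth by (auto simp: pairwise_def orthogonal_def inner_commute)
  have "0 \<notin> ?B"
    using unit by auto
  with po have "independent ?B"
    by (rule pairwise_orthogonal_independent)
  moreover have "card ?B = dim (UNIV :: (real^4) set)"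
    using ne by simp
  ultimately have "x \<in> span ?B"
    by (metis UNIV_I card_eq_dim dim_UNIV finite.emptyI finite.insertI subsetD subset_UNIV)
  moreover have "norm i = 1" if "i \<in> ?B" for i
    using that unit by (auto simp: norm_eq_sqrt_inner)
  ultimately have "(\<Sum>i\<in>?B. (x \<bullet> i) *\<^sub>R i) = x"
    using orthonormal_basis_expand[OF po] by blast
  then show ?thesis
    using ne by (simp add: add.assoc)
qed

section \<open>Functions on an interval with constant derivative\<close>

lemma constant_on_interval:
  fixes \<phi> :: "real \<Rightarrow> 'b::real_normed_vector"
  assumes "is_interval S" "\<And>x. x \<in> S \<Longrightarrow> (\<phi> has_vector_derivative 0) (at x)"
    and "x \<in> S" "y \<in> S"
  shows "\<phi> x = \<phi> y"
proof -
  obtain c where "\<And>x. x \<in> S \<Longrightarrow> \<phi> x = c"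
    using has_vector_derivative_zero_constant[of S \<phi>] assms(1,2)
    by (metis has_vector_derivative_at_within is_interval_convex)
  then show ?thesis
    using assms by simp
qed

lemma linear_on_interval:
  fixes \<phi> :: "real \<Rightarrow> real"
  assumes "is_interval S" "\<And>x. x \<in> S \<Longrightarrow> (\<phi> has_real_derivative a) (at x)"
  shows "\<exists>b. \<forall>x\<in>S. \<phi> x = a * x + b"
proof (cases "S = {}")
  case False
  then obtain x0 where x0: "x0 \<in> S" by blast
  have "((\<lambda>x. \<phi> x - a * x) has_vector_derivative 0) (at x)" if "x \<in> S" for x
    using assms(2)[OF that]
    by (auto simp flip: has_real_derivative_iff_has_vector_derivative intro!: derivative_eq_intros)
  then have "\<phi> x - a * x = \<phi> x0 - a * x0" if "x \<in> S" for x
    using constant_on_interval[OF assms(1) _ that x0, of "\<lambda>x. \<phi> x - a * x"] by blast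
  then have "\<forall>x\<in>S. \<phi> x = a * x + (\<phi> x0 - a * x0)"
    by (simp add: algebra_simps)
  then show ?thesis ..
qed simp

section \<open>The moving frame of the spherical curve\<close>

locale meridian =
  fixes I J :: "real set" and f g :: "real \<Rightarrow> real" and r :: "real \<Rightarrow> real^4"
  assumes data: "meridian_data I J f g r"
    and g'_nonzero: "\<And>u. u \<in> I \<Longrightarrow> deriv g u \<noteq> 0"
begin

lemma openI: "open I" and intervalI: "is_interval I" and I_nonempty: "I \<noteq> {}"
  and openJ: "open J" and intervalJ: "is_interval J" and J_nonempty: "J \<noteq> {}"
  and smooth_f: "smooth_on I f" and smooth_g: "smooth_on I g" and smooth_r: "smooth_on J r"
  using data by (auto simp: meridian_data_def)

lemma f_nonzero: "u \<in> I \<Longrightarrow> f u \<noteq> 0"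
  and arclength: "u \<in> I \<Longrightarrow> (deriv f u)\<^sup>2 + (deriv g u)\<^sup>2 = 1"
  using data by (auto simp: meridian_data_def)

definition t :: "real \<Rightarrow> real^4" where
  "t v = vector_derivative r (at v)"

text \<open>With \<open>n = r \<times> t\<close> the orthonormal frame is completed by \<open>e4\<close>.  The other orientation of \<open>n\<close>
  would reverse the sign of \<open>\<kappa>\<close>; only the vanishing and the constancy of \<open>\<kappa>\<close> matter below.\<close>

definition n :: "real \<Rightarrow> real^4" where
  "n v = crossE (r v) (t v)"

definition \<kappa> :: "real \<Rightarrow> real" where
  "\<kappa> v = vector_derivative t (at v) \<bullet> n v"

lemma smooth_t: "smooth_on J t"
  unfolding t_def[abs_def] by (rule smooth_on_vector_derivative(1)[OF smooth_r openJ])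

lemma smooth_n: "smooth_on J n"
  unfolding n_def[abs_def]
  by (rule smooth_on_bilinear[OF bounded_bilinear_crossE openJ smooth_r smooth_t])

lemma smooth_\<kappa>: "smooth_on J \<kappa>"
  unfolding \<kappa>_def[abs_def]
  by (rule smooth_on_bilinear[OF bounded_bilinear_inner openJ
        smooth_on_vector_derivative(1)[OF smooth_t openJ] smooth_n])

lemma r_deriv: "v \<in> J \<Longrightarrow> (r has_vector_derivative t v) (at v)"
  unfolding t_def by (rule smooth_on_vector_derivative(2)[OF smooth_r openJ])

lemma \<kappa>_deriv: "v \<in> J \<Longrightarrow> (\<kappa> has_vector_derivative deriv \<kappa> v) (at v)"
  using smooth_on_deriv(2)[OF smooth_\<kappa> openJ]
  by (simp add: has_real_derivative_iff_has_vector_derivative)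

lemma r_unit: "v \<in> J \<Longrightarrow> r v \<bullet> r v = 1"
  and r_e4: "v \<in> J \<Longrightarrow> r v \<bullet> e4 = 0"
  and r_E3: "v \<in> J \<Longrightarrow> r v \<in> E3"
  using data by (auto simp: meridian_data_def S2_def image_subset_iff E3_iff inner_axis norm_eq_1)

lemma t_unit: "v \<in> J \<Longrightarrow> t v \<bullet> t v = 1"
  using data by (auto simp: meridian_data_def t_def norm_eq_1)

text \<open>Apart from \<open>t' \<bullet> n\<close>, which defines \<open>\<kappa>\<close>, the components of \<open>t'\<close> and \<open>n'\<close> in the frame come
  from this: the product rule moves the derivative to the other factor, where it is known.\<close>

lemma inner_deriv_const:
  assumes "v \<in> J" "\<And>w. w \<in> J \<Longrightarrow> \<phi> w \<bullet> \<psi> w = c"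
    and "(\<phi> has_vector_derivative \<phi>') (at v)" "(\<psi> has_vector_derivative \<psi>') (at v)"
  shows "\<phi> v \<bullet> \<psi>' + \<phi>' \<bullet> \<psi> v = 0"
proof (rule vector_derivative_unique_at)
  show "((\<lambda>w. \<phi> w \<bullet> \<psi> w) has_vector_derivative \<phi> v \<bullet> \<psi>' + \<phi>' \<bullet> \<psi> v) (at v)"
    by (rule bounded_bilinear.has_vector_derivative[OF bounded_bilinear_inner assms(3,4)])
  show "((\<lambda>w. \<phi> w \<bullet> \<psi> w) has_vector_derivative 0) (at v)"
    by (rule has_vector_derivative_transform_within_open[OF has_vector_derivative_const openJ assms(1)])
      (simp add: assms(2))
qed

lemma r_t: "v \<in> J \<Longrightarrow> r v \<bullet> t v = 0"
  using inner_deriv_const[of v r r, OF _ r_unit r_deriv r_deriv] by (simp add: inner_commute)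

lemma t_e4: "v \<in> J \<Longrightarrow> t v \<bullet> e4 = 0"
  using inner_deriv_const[of v r "\<lambda>_. e4", OF _ r_e4 r_deriv has_vector_derivative_const] by simp

lemma n_e4: "n v \<bullet> e4 = 0"
  by (simp add: n_def inner_axis crossE_nth)

lemma n_r: "n v \<bullet> r v = 0" and n_t: "n v \<bullet> t v = 0"
  by (simp_all add: n_def crossE_orthogonal)

lemma n_unit: "v \<in> J \<Longrightarrow> n v \<bullet> n v = 1"
  unfolding n_def
  using crossE_square[of "r v" "t v"] r_e4[of v] t_e4[of v] r_unit[of v] t_unit[of v] r_t[of v]
  by (simp add: inner_axis)

lemmas frame_products = r_unit t_unit n_unit r_t n_r n_t r_e4 t_e4 n_e4

lemma frame_inner:
  assumes "v \<in> J"
  shows "r v \<bullet> r v = 1" "t v \<bullet> t v = 1" "n v \<bullet> n v = 1" "e4 \<bullet> e4 = 1"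
    "r v \<bullet> t v = 0" "t v \<bullet> r v = 0" "r v \<bullet> n v = 0" "n v \<bullet> r v = 0" "t v \<bullet> n v = 0" "n v \<bullet> t v = 0"
    "r v \<bullet> e4 = 0" "e4 \<bullet> r v = 0" "t v \<bullet> e4 = 0" "e4 \<bullet> t v = 0" "n v \<bullet> e4 = 0" "e4 \<bullet> n v = 0"
  using assms frame_products[of v] by (simp_all add: inner_commute inner_axis_axis)

lemma frame_expand:
  assumes "v \<in> J"
  shows "x = (x \<bullet> r v) *\<^sub>R r v + (x \<bullet> t v) *\<^sub>R t v + (x \<bullet> n v) *\<^sub>R n v + (x \<bullet> e4) *\<^sub>R e4"
  by (rule orthonormal_4_expand) (simp_all add: frame_inner[OF assms])

lemma t_deriv:
  assumes "v \<in> J"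
  shows "(t has_vector_derivative \<kappa> v *\<^sub>R n v - r v) (at v)"
proof -
  let ?a = "vector_derivative t (at v)"
  have D: "(t has_vector_derivative ?a) (at v)"
    by (rule smooth_on_vector_derivative(2)[OF smooth_t openJ assms])
  have "?a \<bullet> r v = - 1"
    using inner_deriv_const[of v r t, OF assms r_t r_deriv[OF assms] D] t_unit[OF assms]
    by (simp add: inner_commute)
  moreover have "?a \<bullet> t v = 0"
    using inner_deriv_const[of v t t, OF assms t_unit D D] by (simp add: inner_commute)
  moreover have "?a \<bullet> e4 = 0"
    using inner_deriv_const[of v t "\<lambda>_. e4", OF assms t_e4 D has_vector_derivative_const] by simp
  ultimately have "?a = \<kappa> v *\<^sub>R n v - r v"
    using frame_expand[OF assms, of ?a] by (simp add: \<kappa>_def)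
  then show ?thesis
    using D by simp
qed

lemma n_deriv:
  assumes "v \<in> J"
  shows "(n has_vector_derivative - \<kappa> v *\<^sub>R t v) (at v)"
proof -
  let ?a = "vector_derivative n (at v)"
  have D: "(n has_vector_derivative ?a) (at v)"
    by (rule smooth_on_vector_derivative(2)[OF smooth_n openJ assms])
  have "?a \<bullet> r v = 0"
    using inner_deriv_const[of v n r, OF assms n_r D r_deriv[OF assms]] n_t by simp
  moreover have "?a \<bullet> t v = - \<kappa> v"
    using inner_deriv_const[of v n t, OF assms n_t D t_deriv[OF assms]] frame_inner[OF assms]
    by (simp add: inner_diff_right)
  moreover have "?a \<bullet> n v = 0"
    using inner_deriv_const[of v n n, OF assms n_unit D D] by (simp add: inner_commute)
  moreover have "?a \<bullet> e4 = 0"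
    using inner_deriv_const[of v n "\<lambda>_. e4", OF assms n_e4 D has_vector_derivative_const] by simp
  ultimately have "?a = - \<kappa> v *\<^sub>R t v"
    using frame_expand[OF assms, of ?a] by simp
  then show ?thesis
    using D by simp
qed

text \<open>The vector \<open>n + \<kappa> r\<close> has derivative \<open>\<kappa>' r\<close>.  If \<open>\<kappa>\<close> is constant, it is the constant normal of
  a plane that contains the curve.\<close>

lemma \<kappa>_const_imp_pole:
  assumes "\<And>v. v \<in> J \<Longrightarrow> \<kappa> v = k"
  shows "\<exists>p\<in>E3. p \<bullet> p = 1 + k\<^sup>2 \<and> r ` J \<subseteq> {x \<in> S2. p \<bullet> x = k}"
proof -
  obtain v0 where v0: "v0 \<in> J" using J_nonempty by blast
  let ?p = "\<lambda>v. n v + k *\<^sub>R r v"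
  have "(?p has_vector_derivative 0) (at v)" if "v \<in> J" for v
    using n_deriv[OF that] r_deriv[OF that] assms[OF that]
    by (auto intro!: derivative_eq_intros)
  then have const: "?p v = ?p v0" if "v \<in> J" for v
    using constant_on_interval[OF intervalJ _ that v0, of ?p] by blast
  have "?p v0 \<in> E3"
    using r_E3[OF v0] by (simp add: E3_iff n_def crossE_nth)
  moreover have "?p v0 \<bullet> ?p v0 = 1 + k\<^sup>2"
    using frame_inner[OF v0] by (simp add: inner_add_left inner_add_right power2_eq_square)
  moreover have "r v \<in> S2 \<and> ?p v0 \<bullet> r v = k" if "v \<in> J" for v
    using that data const[OF that, symmetric] frame_inner[OF that]
    by (auto simp: meridian_data_def inner_add_left)
  ultimately show ?thesis by blast
qed

text \<open>Differentiating \<open>p \<bullet> r = h\<close> twice gives \<open>\<kappa> (p \<bullet> n) = h\<close>, and \<open>p \<bullet> n\<close> is constant since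
  \<open>p \<bullet> t = 0\<close>.  It is not zero, for otherwise \<open>p = h r\<close> and the plane would be tangent to the
  sphere.\<close>

lemma circle_\<kappa>:
  assumes "p \<in> E3" "p \<noteq> 0" "\<bar>h\<bar> < norm p" "r ` J \<subseteq> {x \<in> S2. p \<bullet> x = h}"
  shows "\<exists>b. \<forall>v\<in>J. \<kappa> v = h / b"
proof -
  obtain v0 where v0: "v0 \<in> J" using J_nonempty by blast
  have pr: "p \<bullet> r v = h" if "v \<in> J" for v
    using assms(4) that by auto
  have pt: "p \<bullet> t v = 0" if "v \<in> J" for v
    using inner_deriv_const[of v "\<lambda>_. p" r, OF that pr has_vector_derivative_const r_deriv[OF that]]
    by simp
  have pn: "\<kappa> v * (p \<bullet> n v) = h" if "v \<in> J" for v
    using inner_deriv_const[of v "\<lambda>_. p" t, OF that pt has_vector_derivative_const t_deriv[OF that]]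
      pr[OF that] by (simp add: inner_diff_right)
  have "((\<lambda>v. p \<bullet> n v) has_vector_derivative 0) (at v)" if "v \<in> J" for v
    using bounded_linear.has_vector_derivative[OF bounded_linear_inner_right n_deriv[OF that], of p]
      pt[OF that] by simp
  then have b: "p \<bullet> n v = p \<bullet> n v0" if "v \<in> J" for v
    using constant_on_interval[OF intervalJ _ that v0, of "\<lambda>v. p \<bullet> n v"] by blast
  have "p \<bullet> n v0 \<noteq> 0"
  proof
    assume "p \<bullet> n v0 = 0"
    then have "p = h *\<^sub>R r v0"
      using frame_expand[OF v0, of p] pr[OF v0] pt[OF v0] assms(1) by (simp add: E3_iff inner_axis)
    then have "norm p = \<bar>h\<bar>"
      using r_unit[OF v0] by (simp add: norm_eq_sqrt_inner)
    then show False
      using assms(3) by simp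
  qed
  moreover have "\<kappa> v = h / (p \<bullet> n v0)" if "v \<in> J" for v
    using pn[OF that] b[OF that] \<open>p \<bullet> n v0 \<noteq> 0\<close> by (simp add: nonzero_eq_divide_eq)
  ultimately show ?thesis by blast
qed

lemma is_circle_iff: "is_circle J r \<longleftrightarrow> (\<exists>k. \<forall>v\<in>J. \<kappa> v = k)"
proof
  assume "is_circle J r"
  then obtain p h where p: "p \<in> E3" "p \<noteq> 0" "\<bar>h\<bar> < norm p" "r ` J \<subseteq> {x \<in> S2. p \<bullet> x = h}"
    unfolding is_circle_def by blast
  show "\<exists>k. \<forall>v\<in>J. \<kappa> v = k"
    using circle_\<kappa>[OF p] by blast
next
  assume "\<exists>k. \<forall>v\<in>J. \<kappa> v = k"
  then obtain k where k: "\<And>v. v \<in> J \<Longrightarrow> \<kappa> v = k" by blast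
  obtain p where p: "p \<in> E3" "p \<bullet> p = 1 + k\<^sup>2" "r ` J \<subseteq> {x \<in> S2. p \<bullet> x = k}"
    using \<kappa>_const_imp_pole[OF k] by blast
  have "\<bar>k\<bar> < norm p"
    unfolding norm_eq_sqrt_inner p(2) by (rule real_less_rsqrt) simp
  moreover from this have "p \<noteq> 0" by auto
  ultimately show "is_circle J r"
    unfolding is_circle_def using p by blast
qed

lemma is_great_circle_iff: "is_great_circle J r \<longleftrightarrow> (\<forall>v\<in>J. \<kappa> v = 0)"
proof
  assume "is_great_circle J r"
  then obtain p where p: "p \<in> E3" "p \<noteq> 0" "r ` J \<subseteq> {x \<in> S2. p \<bullet> x = 0}"
    unfolding is_great_circle_def by blast
  show "\<forall>v\<in>J. \<kappa> v = 0"
    using circle_\<kappa>[OF p(1,2) _ p(3)] p(2) by simp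
next
  assume "\<forall>v\<in>J. \<kappa> v = 0"
  then obtain p where p: "p \<in> E3" "p \<bullet> p = 1 + 0\<^sup>2" "r ` J \<subseteq> {x \<in> S2. p \<bullet> x = 0}"
    using \<kappa>_const_imp_pole[of 0] by auto
  from p(2) have "p \<noteq> 0" by auto
  then show "is_great_circle J r"
    unfolding is_great_circle_def using p by blast
qed

end

section \<open>Calculus in the parameters of the surface\<close>

text \<open>Derivatives in the parameters \<open>(u, v)\<close> are recorded by their two partial derivatives, together
  with total differentiability, because the operators on the surface are defined through the
  total derivative.\<close>

definition has_partials ::
  "(real \<times> real \<Rightarrow> 'b::real_normed_vector) \<Rightarrow> 'b \<Rightarrow> 'b \<Rightarrow> real \<times> real \<Rightarrow> bool" where
  "has_partials \<phi> \<phi>u \<phi>v p \<longleftrightarrow>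
     (\<phi> has_derivative (\<lambda>h. fst h *\<^sub>R \<phi>u + snd h *\<^sub>R \<phi>v)) (at p)"

lemma has_partials_frechet:
  "has_partials \<phi> \<phi>u \<phi>v p \<Longrightarrow> frechet_derivative \<phi> (at p) h = fst h *\<^sub>R \<phi>u + snd h *\<^sub>R \<phi>v"
  by (auto simp: has_partials_def dest!: frechet_derivative_at[symmetric])

lemma has_partials_cong:
  assumes "has_partials \<phi> \<phi>u \<phi>v p" "open S" "p \<in> S" "\<And>q. q \<in> S \<Longrightarrow> \<phi> q = \<psi> q"
  shows "has_partials \<psi> \<phi>u \<phi>v p"
  using has_derivative_transform_within_open[OF _ assms(2,3), of \<phi> _ UNIV \<psi>] assms(1,4)
  by (simp add: has_partials_def)

lemma has_partials_add:
  "has_partials \<phi> \<phi>u \<phi>v p \<Longrightarrow> has_partials \<psi> \<psi>u \<psi>v p \<Longrightarrow>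
    has_partials (\<lambda>q. \<phi> q + \<psi> q) (\<phi>u + \<psi>u) (\<phi>v + \<psi>v) p"
  unfolding has_partials_def by (auto intro!: derivative_eq_intros simp: algebra_simps)

lemma has_partials_const: "has_partials (\<lambda>q. c) 0 0 p"
  unfolding has_partials_def by simp

lemma has_partials_fst:
  assumes "(a has_real_derivative a') (at u)"
  shows "has_partials (\<lambda>q. a (fst q)) a' 0 (u, v)"
proof -
  have "((\<lambda>q. a (fst q)) has_derivative (\<lambda>h. a' * fst h)) (at (u, v))"
    by (rule has_derivative_compose[OF has_derivative_fst[OF has_derivative_ident]])
      (use assms in \<open>simp add: has_field_derivative_def\<close>)
  then show ?thesis
    by (simp add: has_partials_def mult.commute)
qed

lemma has_partials_snd:
  assumes "(A has_vector_derivative A') (at v)"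
  shows "has_partials (\<lambda>q. A (snd q)) 0 A' (u, v)"
proof -
  have "((\<lambda>q. A (snd q)) has_derivative (\<lambda>h. snd h *\<^sub>R A')) (at (u, v))"
    by (rule has_derivative_compose[OF has_derivative_snd[OF has_derivative_ident]])
      (use assms in \<open>simp add: has_vector_derivative_def\<close>)
  then show ?thesis
    by (simp add: has_partials_def)
qed

lemma has_partials_scaleR:
  assumes "has_partials a au av p" "has_partials \<phi> \<phi>u \<phi>v p"
  shows "has_partials (\<lambda>q. a q *\<^sub>R \<phi> q) (au *\<^sub>R \<phi> p + a p *\<^sub>R \<phi>u) (av *\<^sub>R \<phi> p + a p *\<^sub>R \<phi>v) p"
  using has_derivative_scaleR[OF assms[unfolded has_partials_def]]
  by (simp add: has_partials_def algebra_simps)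

text \<open>Every field on a meridian surface is a sum of such products of a function of \<open>u\<close> and a
  function of \<open>v\<close>.\<close>

lemma has_partials_separated:
  assumes "(a has_real_derivative a') (at u)" "(A has_vector_derivative A') (at v)"
  shows "has_partials (\<lambda>q. a (fst q) *\<^sub>R A (snd q)) (a' *\<^sub>R A v) (a u *\<^sub>R A') (u, v)"
  using has_partials_scaleR[OF has_partials_fst[OF assms(1)] has_partials_snd[OF assms(2)]] by simp

context meridian
begin

abbreviation "z \<equiv> meridian_surface f g r"
abbreviation "X \<equiv> frame_x f g r"
abbreviation "Y \<equiv> frame_y f g r"
abbreviation "f1 \<equiv> deriv f"
abbreviation "f2 \<equiv> deriv f1"
abbreviation "f3 \<equiv> deriv f2"
abbreviation "g1 \<equiv> deriv g"
abbreviation "g2 \<equiv> deriv g1"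
abbreviation "g3 \<equiv> deriv g2"

lemmas smooth_f1 = smooth_on_deriv(1)[OF smooth_f openI]
lemmas smooth_f2 = smooth_on_deriv(1)[OF smooth_f1 openI]
lemmas smooth_g1 = smooth_on_deriv(1)[OF smooth_g openI]
lemmas smooth_g2 = smooth_on_deriv(1)[OF smooth_g1 openI]

lemma profile_derivs:
  assumes "u \<in> I"
  shows "(f has_real_derivative f1 u) (at u)" "(f1 has_real_derivative f2 u) (at u)"
    "(f2 has_real_derivative f3 u) (at u)" "(g has_real_derivative g1 u) (at u)"
    "(g1 has_real_derivative g2 u) (at u)" "(g2 has_real_derivative g3 u) (at u)"
  using assms smooth_on_deriv(2)[OF _ openI] smooth_f smooth_f1 smooth_f2 smooth_g smooth_g1 smooth_g2
  by blast+

lemma openD: "open (I \<times> J)"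
  using openI openJ by (rule open_Times)

lemma DERIV_cong_open:
  fixes a b :: "real \<Rightarrow> real"
  assumes "(a has_real_derivative a') (at u)" "(b has_real_derivative b') (at u)" "u \<in> I"
    and "\<And>s. s \<in> I \<Longrightarrow> a s = b s"
  shows "a' = b'"
proof -
  have "(b has_real_derivative a') (at u)"
    by (rule has_field_derivative_transform_within_open[OF assms(1) openI assms(3,4)])
  then show ?thesis
    using assms(2) by (rule DERIV_unique)
qed

lemma arclength':
  assumes "u \<in> I"
  shows "f1 u * f2 u + g1 u * g2 u = 0"
proof -
  have "((\<lambda>s. (f1 s)\<^sup>2 + (g1 s)\<^sup>2) has_real_derivative 2 * (f1 u * f2 u + g1 u * g2 u)) (at u)"
    using profile_derivs[OF assms] by (auto intro!: derivative_eq_intros)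
  from DERIV_cong_open[OF this DERIV_const[of 1] assms] arclength
  show ?thesis by simp
qed

lemma arclength'':
  assumes "u \<in> I"
  shows "f1 u * f3 u + g1 u * g3 u = - ((f2 u)\<^sup>2 + (g2 u)\<^sup>2)"
proof -
  have "((\<lambda>s. f1 s * f2 s + g1 s * g2 s) has_real_derivative
      f2 u * f2 u + f1 u * f3 u + (g2 u * g2 u + g1 u * g3 u)) (at u)"
    using profile_derivs[OF assms] by (auto intro!: derivative_eq_intros)
  from DERIV_cong_open[OF this DERIV_const[of 0] assms] arclength'
  show ?thesis by (simp add: power2_eq_square)
qed

section \<open>The tangent frame and its connection\<close>

lemma z_partials:
  assumes "u \<in> I" "v \<in> J"
  shows "has_partials z (f1 u *\<^sub>R r v + g1 u *\<^sub>R e4) (f u *\<^sub>R t v) (u, v)"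
proof -
  have "z = (\<lambda>q. f (fst q) *\<^sub>R r (snd q) + g (fst q) *\<^sub>R e4)"
    by (auto simp: meridian_surface_def)
  then show ?thesis
    using has_partials_add[OF has_partials_separated[OF profile_derivs(1)[OF assms(1)] r_deriv[OF assms(2)]]
        has_partials_separated[OF profile_derivs(4)[OF assms(1)] has_vector_derivative_const]]
    by simp
qed

lemma X_eq: "u \<in> I \<Longrightarrow> v \<in> J \<Longrightarrow> X (u, v) = f1 u *\<^sub>R r v + g1 u *\<^sub>R e4"
  unfolding frame_x_def using has_partials_frechet[OF z_partials] by simp

lemma Y_eq: "u \<in> I \<Longrightarrow> v \<in> J \<Longrightarrow> Y (u, v) = t v"
  unfolding frame_y_def using has_partials_frechet[OF z_partials] f_nonzero by simp

lemma XY_orthonormal: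
  assumes "u \<in> I" "v \<in> J"
  shows "X (u, v) \<bullet> X (u, v) = 1" "Y (u, v) \<bullet> Y (u, v) = 1" "X (u, v) \<bullet> Y (u, v) = 0"
    "Y (u, v) \<bullet> X (u, v) = 0"
  using assms arclength[OF assms(1)] frame_inner[OF assms(2)]
  by (simp_all add: X_eq Y_eq inner_add_left inner_add_right power2_eq_square)

lemma X_partials:
  assumes "u \<in> I" "v \<in> J"
  shows "has_partials X (f2 u *\<^sub>R r v + g2 u *\<^sub>R e4) (f1 u *\<^sub>R t v) (u, v)"
proof (rule has_partials_cong[OF _ openD])
  show "has_partials (\<lambda>q. f1 (fst q) *\<^sub>R r (snd q) + g1 (fst q) *\<^sub>R e4)
      (f2 u *\<^sub>R r v + g2 u *\<^sub>R e4) (f1 u *\<^sub>R t v) (u, v)"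
    using has_partials_add[OF has_partials_separated[OF profile_derivs(2)[OF assms(1)] r_deriv[OF assms(2)]]
        has_partials_separated[OF profile_derivs(5)[OF assms(1)] has_vector_derivative_const]]
    by simp
qed (use assms X_eq in auto)

lemma Y_partials:
  assumes "u \<in> I" "v \<in> J"
  shows "has_partials Y 0 (\<kappa> v *\<^sub>R n v - r v) (u, v)"
  by (rule has_partials_cong[OF has_partials_snd[OF t_deriv[OF assms(2)]] openD])
    (use assms Y_eq in auto)

text \<open>The differential of the parametrization sends \<open>(1, 0)\<close> to \<open>X\<close> and \<open>(0, 1)\<close> to \<open>f Y\<close>, so
  \<open>\<alpha> X + \<beta> Y\<close> is the image of \<open>(\<alpha>, \<beta> / f)\<close> and, by orthonormality, of nothing else.\<close>

lemma flat_deriv_eq: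
  assumes uv: "u \<in> I" "v \<in> J" and \<phi>: "has_partials \<phi> \<phi>u \<phi>v (u, v)"
    and W: "W (u, v) = \<alpha> *\<^sub>R X (u, v) + \<beta> *\<^sub>R Y (u, v)"
  shows "flat_deriv z W \<phi> (u, v) = \<alpha> *\<^sub>R \<phi>u + (\<beta> / f u) *\<^sub>R \<phi>v"
proof -
  have dz: "frechet_derivative z (at (u, v)) h = fst h *\<^sub>R X (u, v) + (snd h * f u) *\<^sub>R Y (u, v)" for h
    using has_partials_frechet[OF z_partials[OF uv]] by (simp add: X_eq[OF uv] Y_eq[OF uv])
  have "(THE h. frechet_derivative z (at (u, v)) h = W (u, v)) = (\<alpha>, \<beta> / f u)"
  proof (rule the_equality)
    show "frechet_derivative z (at (u, v)) (\<alpha>, \<beta> / f u) = W (u, v)"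
      using f_nonzero[OF uv(1)] by (simp add: dz W)
    fix h
    assume "frechet_derivative z (at (u, v)) h = W (u, v)"
    then have eq: "fst h *\<^sub>R X (u, v) + (snd h * f u) *\<^sub>R Y (u, v) = \<alpha> *\<^sub>R X (u, v) + \<beta> *\<^sub>R Y (u, v)"
      by (simp add: dz W)
    have "fst h = \<alpha>"
      using arg_cong[OF eq, of "\<lambda>w. w \<bullet> X (u, v)"] XY_orthonormal[OF uv]
      by (simp add: inner_add_left)
    moreover have "snd h * f u = \<beta>"
      using arg_cong[OF eq, of "\<lambda>w. w \<bullet> Y (u, v)"] XY_orthonormal[OF uv]
      by (simp add: inner_add_left)
    ultimately show "h = (\<alpha>, \<beta> / f u)"
      using f_nonzero[OF uv(1)] by (auto simp: prod_eq_iff)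
  qed
  then show ?thesis
    using has_partials_frechet[OF \<phi>] by (simp add: flat_deriv_def)
qed

lemma levi_civita_eq:
  assumes uv: "u \<in> I" "v \<in> J" and \<phi>: "has_partials \<phi> \<phi>u \<phi>v (u, v)"
    and W: "W (u, v) = \<alpha> *\<^sub>R X (u, v) + \<beta> *\<^sub>R Y (u, v)"
  shows "levi_civita z X Y W \<phi> (u, v) =
    (\<alpha> * (\<phi>u \<bullet> X (u, v)) + \<beta> / f u * (\<phi>v \<bullet> X (u, v))) *\<^sub>R X (u, v)
    + (\<alpha> * (\<phi>u \<bullet> Y (u, v)) + \<beta> / f u * (\<phi>v \<bullet> Y (u, v))) *\<^sub>R Y (u, v)"
proof -
  have "flat_deriv z W \<phi> (u, v) = \<alpha> *\<^sub>R \<phi>u + (\<beta> / f u) *\<^sub>R \<phi>v"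
    using assms by (rule flat_deriv_eq)
  then show ?thesis
    by (simp add: levi_civita_def inner_add_left)
qed

text \<open>These are the connection coefficients of the metric \<open>du\<^sup>2 + f\<^sup>2 dv\<^sup>2\<close>.\<close>

lemma frame_connection:
  assumes uv: "u \<in> I" "v \<in> J"
  shows "levi_civita z X Y X X (u, v) = 0" "levi_civita z X Y X Y (u, v) = 0"
    "levi_civita z X Y Y X (u, v) = (f1 u / f u) *\<^sub>R Y (u, v)"
    "levi_civita z X Y Y Y (u, v) = (- f1 u / f u) *\<^sub>R X (u, v)"
proof -
  note X = levi_civita_eq[OF uv X_partials[OF uv]] and Y = levi_civita_eq[OF uv Y_partials[OF uv]]
  note simps = X_eq[OF uv] Y_eq[OF uv] inner_add_left inner_add_right inner_diff_left
    frame_inner[OF uv(2)]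
  show "levi_civita z X Y X X (u, v) = 0"
    using X[of X 1 0] arclength'[OF uv(1)] by (simp add: simps mult.commute)
  show "levi_civita z X Y X Y (u, v) = 0"
    using Y[of X 1 0] by (simp add: simps)
  show "levi_civita z X Y Y X (u, v) = (f1 u / f u) *\<^sub>R Y (u, v)"
    using X[of Y 0 1] by (simp add: simps)
  show "levi_civita z X Y Y Y (u, v) = (- f1 u / f u) *\<^sub>R X (u, v)"
    using Y[of Y 0 1] by (simp add: simps)
qed

lemma gauss_curvature_eq:
  assumes uv: "u \<in> I" "v \<in> J"
  shows "gauss_curvature z X Y (u, v) = - f2 u / f u"
proof -
  let ?D = "levi_civita z X Y"
  let ?B = "\<lambda>q. ?D X Y q - ?D Y X q"
  have fu: "f u \<noteq> 0" by (rule f_nonzero[OF uv(1)])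
  note simps = X_eq[OF uv] Y_eq[OF uv] inner_add_left inner_add_right inner_diff_left
    frame_inner[OF uv(2)]
  have c: "((\<lambda>s. - f1 s / f s) has_real_derivative - f2 u / f u + (f1 u / f u)\<^sup>2) (at u)"
    using profile_derivs[OF uv(1)] fu
    by (auto intro!: derivative_eq_intros simp: field_simps power2_eq_square)
  have "has_partials (\<lambda>q. (- f1 (fst q) / f (fst q)) *\<^sub>R X q)
      ((- f2 u / f u + (f1 u / f u)\<^sup>2) *\<^sub>R X (u, v) + (- f1 u / f u) *\<^sub>R (f2 u *\<^sub>R r v + g2 u *\<^sub>R e4))
      ((- f1 u / f u) *\<^sub>R (f1 u *\<^sub>R t v)) (u, v)"
    using has_partials_scaleR[OF has_partials_fst[OF c] X_partials[OF uv]] by simp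
  then have "has_partials (?D Y Y)
      ((- f2 u / f u + (f1 u / f u)\<^sup>2) *\<^sub>R X (u, v) + (- f1 u / f u) *\<^sub>R (f2 u *\<^sub>R r v + g2 u *\<^sub>R e4))
      ((- f1 u / f u) *\<^sub>R (f1 u *\<^sub>R t v)) (u, v)"
    by (rule has_partials_cong[OF _ openD]) (use uv frame_connection(4) in auto)
  from levi_civita_eq[OF uv this, of X 1 0]
  have "?D X (?D Y Y) (u, v) \<bullet> X (u, v) = - f2 u / f u + (f1 u / f u)\<^sup>2
      + (- f1 u / f u) * ((f2 u *\<^sub>R r v + g2 u *\<^sub>R e4) \<bullet> X (u, v))"
    using XY_orthonormal[OF uv] by (simp add: inner_add_left inner_diff_left)
  also have "(f2 u *\<^sub>R r v + g2 u *\<^sub>R e4) \<bullet> X (u, v) = 0"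
    using arclength'[OF uv(1)] by (simp add: simps mult.commute)
  finally have 1: "?D X (?D Y Y) (u, v) \<bullet> X (u, v) = - f2 u / f u + (f1 u / f u)\<^sup>2" by simp
  have "has_partials (?D X Y) 0 0 (u, v)"
    by (rule has_partials_cong[OF has_partials_const openD]) (use uv frame_connection(2) in auto)
  from levi_civita_eq[OF uv this, of Y 0 1] have 2: "?D Y (?D X Y) (u, v) = 0" by simp
  have Yv: "(\<kappa> v *\<^sub>R n v - r v) \<bullet> X (u, v) = - f1 u" "(\<kappa> v *\<^sub>R n v - r v) \<bullet> Y (u, v) = 0"
    by (simp_all add: simps)
  have "?B (u, v) = 0 *\<^sub>R X (u, v) + (- f1 u / f u) *\<^sub>R Y (u, v)"
    by (simp add: frame_connection[OF uv])
  from levi_civita_eq[OF uv Y_partials[OF uv], of ?B, OF this]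
  have 3: "?D ?B Y (u, v) \<bullet> X (u, v) = (f1 u / f u)\<^sup>2"
    using XY_orthonormal[OF uv] by (simp add: Yv power2_eq_square)
  show ?thesis
    unfolding gauss_curvature_def Let_def inner_diff_left 1 2 3 by simp
qed

text \<open>The only first-order term comes from \<open>\<nabla>\<^sub>Y Y = - (f' / f) X\<close>.\<close>

lemma laplacian_eq:
  assumes uv: "u \<in> I" "v \<in> J"
    and \<phi>: "\<And>u v. u \<in> I \<Longrightarrow> v \<in> J \<Longrightarrow> has_partials \<phi> (\<phi>u (u, v)) (\<phi>v (u, v)) (u, v)"
    and \<phi>u: "has_partials \<phi>u \<phi>uu \<phi>uv (u, v)" and \<phi>v: "has_partials \<phi>v \<phi>vu \<phi>vv (u, v)"
  shows "laplacian z X Y \<phi> (u, v) =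
    - (\<phi>uu + (f1 u / f u) *\<^sub>R \<phi>u (u, v) + (1 / (f u)\<^sup>2) *\<^sub>R \<phi>vv)"
proof -
  have fu: "f u \<noteq> 0" by (rule f_nonzero[OF uv(1)])
  have X: "flat_deriv z X \<phi> (u, v) = \<phi>u (u, v)" if "u \<in> I" "v \<in> J" for u v
    using flat_deriv_eq[OF that \<phi>[OF that], of X 1 0] by simp
  have Y: "flat_deriv z Y \<phi> (u, v) = (1 / f u) *\<^sub>R \<phi>v (u, v)" if "u \<in> I" "v \<in> J" for u v
    using flat_deriv_eq[OF that \<phi>[OF that], of Y 0 1] by simp
  have "has_partials (flat_deriv z X \<phi>) \<phi>uu \<phi>uv (u, v)"
    by (rule has_partials_cong[OF \<phi>u openD]) (use uv X in auto)
  from flat_deriv_eq[OF uv this, of X 1 0]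
  have XX: "flat_deriv z X (flat_deriv z X \<phi>) (u, v) = \<phi>uu" by simp
  have c: "((\<lambda>s. 1 / f s) has_real_derivative - f1 u / (f u)\<^sup>2) (at u)"
    using profile_derivs[OF uv(1)] fu
    by (auto intro!: derivative_eq_intros simp: field_simps power2_eq_square)
  have "has_partials (\<lambda>q. (1 / f (fst q)) *\<^sub>R \<phi>v q)
      ((- f1 u / (f u)\<^sup>2) *\<^sub>R \<phi>v (u, v) + (1 / f u) *\<^sub>R \<phi>vu) ((1 / f u) *\<^sub>R \<phi>vv) (u, v)"
    using has_partials_scaleR[OF has_partials_fst[OF c] \<phi>v] by simp
  then have "has_partials (flat_deriv z Y \<phi>)
      ((- f1 u / (f u)\<^sup>2) *\<^sub>R \<phi>v (u, v) + (1 / f u) *\<^sub>R \<phi>vu) ((1 / f u) *\<^sub>R \<phi>vv) (u, v)"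
    by (rule has_partials_cong[OF _ openD]) (use uv Y in auto)
  from flat_deriv_eq[OF uv this, of Y 0 1]
  have YY: "flat_deriv z Y (flat_deriv z Y \<phi>) (u, v) = (1 / (f u)\<^sup>2) *\<^sub>R \<phi>vv"
    by (simp add: power2_eq_square)
  have LX: "flat_deriv z (levi_civita z X Y X X) \<phi> (u, v) = 0"
    using flat_deriv_eq[OF uv \<phi>[OF uv], of "levi_civita z X Y X X" 0 0] frame_connection[OF uv]
    by simp
  have LY: "flat_deriv z (levi_civita z X Y Y Y) \<phi> (u, v) = - ((f1 u / f u) *\<^sub>R \<phi>u (u, v))"
    using flat_deriv_eq[OF uv \<phi>[OF uv], of "levi_civita z X Y Y Y" "- f1 u / f u" 0]
      frame_connection[OF uv] by simp
  show ?thesis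
    by (simp add: laplacian_def XX YY LX LY)
qed

section \<open>The Laplacian of the Gauss map\<close>

lemma gauss_map_eq:
  "u \<in> I \<Longrightarrow> v \<in> J \<Longrightarrow>
    gauss_map X Y (u, v) = f1 u *\<^sub>R wedge (r v) (t v) + g1 u *\<^sub>R wedge e4 (t v)"
  by (simp add: gauss_map_def X_eq Y_eq bounded_bilinear.add_left[OF bounded_bilinear_wedge]
      bounded_bilinear.scaleR_left[OF bounded_bilinear_wedge])

text \<open>The bivectors of the frame are closed under differentiation along the curve, so that the
  derivatives of \<open>G\<close> are again combinations of them with coefficients in \<open>u\<close> and \<open>\<kappa>\<close>.\<close>

lemma wedge_derivs:
  assumes "v \<in> J"
  shows "((\<lambda>v. wedge (r v) (t v)) has_vector_derivative \<kappa> v *\<^sub>R wedge (r v) (n v)) (at v)"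
    "((\<lambda>v. wedge e4 (t v)) has_vector_derivative
        \<kappa> v *\<^sub>R wedge e4 (n v) - wedge e4 (r v)) (at v)"
    "((\<lambda>v. wedge (r v) (n v)) has_vector_derivative
        wedge (t v) (n v) - \<kappa> v *\<^sub>R wedge (r v) (t v)) (at v)"
    "((\<lambda>v. wedge e4 (n v)) has_vector_derivative - \<kappa> v *\<^sub>R wedge e4 (t v)) (at v)"
    "((\<lambda>v. wedge e4 (r v)) has_vector_derivative wedge e4 (t v)) (at v)"
    "((\<lambda>v. wedge (t v) (n v)) has_vector_derivative - wedge (r v) (n v)) (at v)"
proof -
  note D = bounded_bilinear.has_vector_derivative[OF bounded_bilinear_wedge]
  note simps = bounded_bilinear.add_left[OF bounded_bilinear_wedge]
    bounded_bilinear.add_right[OF bounded_bilinear_wedge]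
    bounded_bilinear.diff_left[OF bounded_bilinear_wedge]
    bounded_bilinear.diff_right[OF bounded_bilinear_wedge]
    bounded_bilinear.scaleR_left[OF bounded_bilinear_wedge]
    bounded_bilinear.scaleR_right[OF bounded_bilinear_wedge]
    bounded_bilinear.minus_right[OF bounded_bilinear_wedge]
    bounded_bilinear.zero_left[OF bounded_bilinear_wedge]
    wedge_self
  note F = r_deriv[OF assms] t_deriv[OF assms] n_deriv[OF assms] has_vector_derivative_const[of e4]
  show "((\<lambda>v. wedge (r v) (t v)) has_vector_derivative \<kappa> v *\<^sub>R wedge (r v) (n v)) (at v)"
    using D[OF F(1,2)] by (simp add: simps)
  show "((\<lambda>v. wedge e4 (t v)) has_vector_derivative
      \<kappa> v *\<^sub>R wedge e4 (n v) - wedge e4 (r v)) (at v)"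
    using D[OF F(4,2)] by (simp add: simps)
  show "((\<lambda>v. wedge (r v) (n v)) has_vector_derivative
      wedge (t v) (n v) - \<kappa> v *\<^sub>R wedge (r v) (t v)) (at v)"
    using D[OF F(1,3)] by (simp add: simps)
  show "((\<lambda>v. wedge e4 (n v)) has_vector_derivative - \<kappa> v *\<^sub>R wedge e4 (t v)) (at v)"
    using D[OF F(4,3)] by (simp add: simps)
  show "((\<lambda>v. wedge e4 (r v)) has_vector_derivative wedge e4 (t v)) (at v)"
    using D[OF F(4,1)] by (simp add: simps)
  show "((\<lambda>v. wedge (t v) (n v)) has_vector_derivative - wedge (r v) (n v)) (at v)"
    using D[OF F(2,3)] by (simp add: simps)
qed

text \<open>The \<open>e4 \<and> r\<close> component vanishes.  For \<open>\<Delta>G = \<lambda>(G + C)\<close> this forces \<open>C\<close> to have no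
  \<open>e4 \<and> r\<close> component either, which is the starting point of the necessity proof.\<close>

lemma laplacian_gauss_map:
  assumes uv: "u \<in> I" "v \<in> J"
  shows "laplacian z X Y (gauss_map X Y) (u, v) =
    - ((f3 u + f1 u / f u * f2 u - f1 u * (\<kappa> v)\<^sup>2 / (f u)\<^sup>2) *\<^sub>R wedge (r v) (t v)
     + (g3 u + f1 u / f u * g2 u - g1 u * ((\<kappa> v)\<^sup>2 + 1) / (f u)\<^sup>2) *\<^sub>R wedge e4 (t v)
     + (f1 u * deriv \<kappa> v / (f u)\<^sup>2) *\<^sub>R wedge (r v) (n v)
     + (g1 u * deriv \<kappa> v / (f u)\<^sup>2) *\<^sub>R wedge e4 (n v)
     + (f1 u * \<kappa> v / (f u)\<^sup>2) *\<^sub>R wedge (t v) (n v))"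
proof -
  let ?rt = "\<lambda>v. wedge (r v) (t v)" and ?et = "\<lambda>v. wedge e4 (t v)"
    and ?rn = "\<lambda>v. wedge (r v) (n v)" and ?en = "\<lambda>v. wedge e4 (n v)"
    and ?tn = "\<lambda>v. wedge (t v) (n v)" and ?er = "\<lambda>v. wedge e4 (r v)"
  define Gu where "Gu = (\<lambda>q. f2 (fst q) *\<^sub>R ?rt (snd q) + g2 (fst q) *\<^sub>R ?et (snd q))"
  define rtv where "rtv = (\<lambda>v. \<kappa> v *\<^sub>R ?rn v)"
  define etv where "etv = (\<lambda>v. \<kappa> v *\<^sub>R ?en v - ?er v)"
  define Gv where "Gv = (\<lambda>q. f1 (fst q) *\<^sub>R rtv (snd q) + g1 (fst q) *\<^sub>R etv (snd q))"
  have G: "has_partials (gauss_map X Y) (Gu (u, v)) (Gv (u, v)) (u, v)" if uv: "u \<in> I" "v \<in> J" for u v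
  proof (rule has_partials_cong[OF _ openD])
    have "rtv v = \<kappa> v *\<^sub>R ?rn v" "etv v = \<kappa> v *\<^sub>R ?en v - ?er v"
      by (simp_all add: rtv_def etv_def)
    then show "has_partials (\<lambda>q. f1 (fst q) *\<^sub>R ?rt (snd q) + g1 (fst q) *\<^sub>R ?et (snd q))
        (Gu (u, v)) (Gv (u, v)) (u, v)"
      unfolding Gu_def Gv_def
      using has_partials_add[OF
          has_partials_separated[OF profile_derivs(2)[OF uv(1)] wedge_derivs(1)[OF uv(2)]]
          has_partials_separated[OF profile_derivs(5)[OF uv(1)] wedge_derivs(2)[OF uv(2)]]]
      by simp
  qed (use uv gauss_map_eq in auto)
  have Gu: "has_partials Gu (f3 u *\<^sub>R ?rt v + g3 u *\<^sub>R ?et v)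
      (f2 u *\<^sub>R (\<kappa> v *\<^sub>R ?rn v) + g2 u *\<^sub>R (\<kappa> v *\<^sub>R ?en v - ?er v)) (u, v)"
    unfolding Gu_def
    by (rule has_partials_add[OF
          has_partials_separated[OF profile_derivs(3)[OF uv(1)] wedge_derivs(1)[OF uv(2)]]
          has_partials_separated[OF profile_derivs(6)[OF uv(1)] wedge_derivs(2)[OF uv(2)]]])
  define rtvv where "rtvv = \<kappa> v *\<^sub>R (?tn v - \<kappa> v *\<^sub>R ?rt v) + deriv \<kappa> v *\<^sub>R ?rn v"
  define etvv where "etvv = \<kappa> v *\<^sub>R (- \<kappa> v *\<^sub>R ?et v) + deriv \<kappa> v *\<^sub>R ?en v - ?et v"
  have \<kappa>': "(\<kappa> has_real_derivative deriv \<kappa> v) (at v)"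
    using \<kappa>_deriv[OF uv(2)] by (simp add: has_real_derivative_iff_has_vector_derivative)
  have rtv': "(rtv has_vector_derivative rtvv) (at v)"
    unfolding rtv_def rtvv_def
    by (rule has_vector_derivative_scaleR[OF \<kappa>' wedge_derivs(3)[OF uv(2)]])
  have etv': "(etv has_vector_derivative etvv) (at v)"
    unfolding etv_def etvv_def
    by (rule has_vector_derivative_diff[OF
          has_vector_derivative_scaleR[OF \<kappa>' wedge_derivs(4)[OF uv(2)]] wedge_derivs(5)[OF uv(2)]])
  have Gv: "has_partials Gv (f2 u *\<^sub>R rtv v + g2 u *\<^sub>R etv v) (f1 u *\<^sub>R rtvv + g1 u *\<^sub>R etvv) (u, v)"
    unfolding Gv_def
    by (rule has_partials_add[OF
          has_partials_separated[OF profile_derivs(2)[OF uv(1)] rtv']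
          has_partials_separated[OF profile_derivs(5)[OF uv(1)] etv']])
  have "laplacian z X Y (gauss_map X Y) (u, v) =
    - ((f3 u *\<^sub>R ?rt v + g3 u *\<^sub>R ?et v) + (f1 u / f u) *\<^sub>R Gu (u, v)
      + (1 / (f u)\<^sup>2) *\<^sub>R (f1 u *\<^sub>R rtvv + g1 u *\<^sub>R etvv))"
    using uv G Gu Gv by (rule laplacian_eq)
  then show ?thesis
    by (simp add: Gu_def rtvv_def etvv_def scaleR_add_right scaleR_diff_right scaleR_add_left
        scaleR_diff_left power2_eq_square add_divide_distrib diff_divide_distrib ring_distribs
        mult_ac)
qed

end

section \<open>Reduction to equations along the meridian\<close>

context meridian
begin

abbreviation "G \<equiv> gauss_map X Y"

text \<open>This is what remains of \<open>\<Delta>G = \<lambda>(G + C)\<close> along a meridian when \<open>\<kappa> = k\<close> is constant and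
  \<open>C = c (r \<and> t + k t \<and> n)\<close>: the components at \<open>r \<and> t\<close>, \<open>e4 \<and> t\<close> and \<open>t \<and> n\<close>.\<close>

definition gauss_system :: "real \<Rightarrow> real \<Rightarrow> (real \<Rightarrow> real) \<Rightarrow> bool" where
  "gauss_system k c l \<longleftrightarrow> c \<noteq> 0 \<and> (\<forall>u\<in>I. l u \<noteq> 0 \<and>
     f3 u + f1 u / f u * f2 u - f1 u * k\<^sup>2 / (f u)\<^sup>2 = - l u * (f1 u + c) \<and>
     g3 u + f1 u / f u * g2 u - g1 u * (k\<^sup>2 + 1) / (f u)\<^sup>2 = - l u * g1 u \<and>
     f1 u * k / (f u)\<^sup>2 = - l u * (k * c))"

lemma deriv_of_const:
  assumes "v \<in> J" "\<And>w. w \<in> J \<Longrightarrow> \<phi> w = c" "(\<phi> has_vector_derivative d) (at v)"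
  shows "d = 0"
proof (rule vector_derivative_unique_at[OF assms(3)])
  show "(\<phi> has_vector_derivative 0) (at v)"
    by (rule has_vector_derivative_transform_within_open[OF has_vector_derivative_const openJ assms(1)])
      (simp add: assms(2))
qed

text \<open>A constant bivector has components in the moving frame that vary along the curve by these
  equations, which are dual to the Frenet equations.\<close>

lemma coeff_derivs:
  assumes "v \<in> J" "C \<in> bivectors"
  shows "((\<lambda>v. coeff_on e4 (r v) C) has_vector_derivative coeff_on e4 (t v) C) (at v)"
    "((\<lambda>v. coeff_on e4 (t v) C) has_vector_derivative
        \<kappa> v * coeff_on e4 (n v) C - coeff_on e4 (r v) C) (at v)"
    "((\<lambda>v. coeff_on e4 (n v) C) has_vector_derivative - \<kappa> v * coeff_on e4 (t v) C) (at v)"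
    "((\<lambda>v. coeff_on (r v) (t v) C) has_vector_derivative \<kappa> v * coeff_on (r v) (n v) C) (at v)"
    "((\<lambda>v. coeff_on (r v) (n v) C) has_vector_derivative
        coeff_on (t v) (n v) C - \<kappa> v * coeff_on (r v) (t v) C) (at v)"
proof -
  note B = bounded_bilinear_coeff_on[of C]
  note D = bounded_bilinear.has_vector_derivative[OF B]
  note simps = bounded_bilinear.add_right[OF B] bounded_bilinear.diff_right[OF B]
    bounded_bilinear.scaleR_right[OF B] bounded_bilinear.minus_right[OF B]
    bounded_bilinear.zero_left[OF B] coeff_on_same[OF assms(2)]
  note F = r_deriv[OF assms(1)] t_deriv[OF assms(1)] n_deriv[OF assms(1)]
    has_vector_derivative_const[of e4]
  show "((\<lambda>v. coeff_on e4 (r v) C) has_vector_derivative coeff_on e4 (t v) C) (at v)"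
    using D[OF F(4,1)] by (simp add: simps)
  show "((\<lambda>v. coeff_on e4 (t v) C) has_vector_derivative
      \<kappa> v * coeff_on e4 (n v) C - coeff_on e4 (r v) C) (at v)"
    using D[OF F(4,2)] by (simp add: simps)
  show "((\<lambda>v. coeff_on e4 (n v) C) has_vector_derivative - \<kappa> v * coeff_on e4 (t v) C) (at v)"
    using D[OF F(4,3)] by (simp add: simps)
  show "((\<lambda>v. coeff_on (r v) (t v) C) has_vector_derivative \<kappa> v * coeff_on (r v) (n v) C) (at v)"
    using D[OF F(1,2)] by (simp add: simps)
  show "((\<lambda>v. coeff_on (r v) (n v) C) has_vector_derivative
      coeff_on (t v) (n v) C - \<kappa> v * coeff_on (r v) (t v) C) (at v)"
    using D[OF F(1,3)] by (simp add: simps)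
qed

lemma bivector_eq_0:
  assumes "v \<in> J" "C \<in> bivectors"
    and "coeff_on (r v) (t v) C = 0" "coeff_on (r v) (n v) C = 0" "coeff_on (t v) (n v) C = 0"
    and "coeff_on e4 (r v) C = 0" "coeff_on e4 (t v) C = 0" "coeff_on e4 (n v) C = 0"
  shows "C = 0"
proof -
  have s: "coeff_on (t v) (r v) C = 0" "coeff_on (n v) (r v) C = 0" "coeff_on (n v) (t v) C = 0"
    "coeff_on (r v) e4 C = 0" "coeff_on (t v) e4 C = 0" "coeff_on (n v) e4 C = 0"
    using assms(3-8) coeff_on_skew[OF assms(2)] by (metis neg_equal_0_iff_equal)+
  have *: "C *v q = 0" if "q \<in> {r v, t v, n v, e4}" for q
    using frame_expand[OF assms(1), of "C *v q"] that assms(3-8) s coeff_on_same[OF assms(2)]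
    by (auto simp: coeff_on_def inner_commute)
  have "C *v x = 0 *v x" for x
    by (subst frame_expand[OF assms(1), of x])
      (simp add: matrix_vector_right_distrib matrix_vector_mult_scaleR *)
  then show ?thesis
    by (simp add: matrix_eq)
qed

lemma coeff_equations:
  assumes uv: "u \<in> I" "v \<in> J" and eq: "laplacian z X Y G (u, v) = l *\<^sub>R (G (u, v) + C)"
  shows "f3 u + f1 u / f u * f2 u - f1 u * (\<kappa> v)\<^sup>2 / (f u)\<^sup>2 = - l * (f1 u + coeff_on (r v) (t v) C)"
    "g3 u + f1 u / f u * g2 u - g1 u * ((\<kappa> v)\<^sup>2 + 1) / (f u)\<^sup>2 = - l * (g1 u + coeff_on e4 (t v) C)"
    "f1 u * deriv \<kappa> v / (f u)\<^sup>2 = - l * coeff_on (r v) (n v) C"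
    "g1 u * deriv \<kappa> v / (f u)\<^sup>2 = - l * coeff_on e4 (n v) C"
    "f1 u * \<kappa> v / (f u)\<^sup>2 = - l * coeff_on (t v) (n v) C"
    "0 = - l * coeff_on e4 (r v) C"
proof -
  note c = arg_cong[OF eq[unfolded laplacian_gauss_map[OF uv] gauss_map_eq[OF uv]]]
  note simps = coeff_on_simps frame_inner[OF uv(2)]
  show "f3 u + f1 u / f u * f2 u - f1 u * (\<kappa> v)\<^sup>2 / (f u)\<^sup>2 = - l * (f1 u + coeff_on (r v) (t v) C)"
    using c[of "coeff_on (r v) (t v)"] unfolding simps by (simp add: algebra_simps)
  show "g3 u + f1 u / f u * g2 u - g1 u * ((\<kappa> v)\<^sup>2 + 1) / (f u)\<^sup>2 = - l * (g1 u + coeff_on e4 (t v) C)"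
    using c[of "coeff_on e4 (t v)"] unfolding simps by (simp add: algebra_simps)
  show "f1 u * deriv \<kappa> v / (f u)\<^sup>2 = - l * coeff_on (r v) (n v) C"
    using c[of "coeff_on (r v) (n v)"] unfolding simps by (simp add: algebra_simps)
  show "g1 u * deriv \<kappa> v / (f u)\<^sup>2 = - l * coeff_on e4 (n v) C"
    using c[of "coeff_on e4 (n v)"] unfolding simps by (simp add: algebra_simps)
  show "f1 u * \<kappa> v / (f u)\<^sup>2 = - l * coeff_on (t v) (n v) C"
    using c[of "coeff_on (t v) (n v)"] unfolding simps by (simp add: algebra_simps)
  show "0 = - l * coeff_on e4 (r v) C"
    using c[of "coeff_on e4 (r v)"] unfolding simps by (simp add: algebra_simps)
qed

text \<open>The component of \<open>C\<close> at \<open>e4 \<and> r\<close> vanishes, hence so does its derivative, the component at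
  \<open>e4 \<and> t\<close>, and then \<open>\<kappa>\<close> times the component at \<open>e4 \<and> n\<close>.  The last component is constant, so
  either it vanishes, and then the equation at \<open>e4 \<and> n\<close> gives \<open>\<kappa>' = 0\<close> because \<open>g' \<noteq> 0\<close>, or
  \<open>\<kappa>\<close> vanishes identically.  In both cases \<open>\<kappa>\<close> is constant, and a single free component \<open>c\<close> of
  \<open>C\<close> is left.\<close>

lemma second_kind_imp_gauss_system:
  assumes "pointwise_1_type_second_kind (I \<times> J) z X Y"
  shows "\<exists>k c l. (\<forall>v\<in>J. \<kappa> v = k) \<and> gauss_system k c l"
proof -
  obtain C L where C: "C \<in> bivectors" "C \<noteq> 0" and L: "\<forall>p\<in>I \<times> J. L p \<noteq> 0"
    and eq: "\<forall>p\<in>I \<times> J. laplacian z X Y G p = L p *\<^sub>R (G p + C)"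
    using assms unfolding pointwise_1_type_second_kind_def pointwise_1_type_def
    by (elim bexE conjE exE)
  obtain u0 v0 where u0: "u0 \<in> I" and v0: "v0 \<in> J"
    using I_nonempty J_nonempty by blast
  have E: "laplacian z X Y G (u, v) = L (u, v) *\<^sub>R (G (u, v) + C)" "L (u, v) \<noteq> 0"
    if "u \<in> I" "v \<in> J" for u v
    using that eq L by auto
  note eqs = coeff_equations[OF _ _ E(1)]
  note D = coeff_derivs[OF _ C(1)]
  have er: "coeff_on e4 (r v) C = 0" if "v \<in> J" for v
    using eqs(6)[OF u0 that u0 that] E(2)[OF u0 that] by simp
  have et: "coeff_on e4 (t v) C = 0" if "v \<in> J" for v
    using deriv_of_const[OF that er D(1)[OF that]] .
  have \<kappa>en: "\<kappa> v * coeff_on e4 (n v) C = 0" if "v \<in> J" for v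
    using deriv_of_const[OF that et D(2)[OF that]] er[OF that] by simp
  have "((\<lambda>v. coeff_on e4 (n v) C) has_vector_derivative 0) (at v)" if "v \<in> J" for v
    using D(3)[OF that] et[OF that] by simp
  then have en_const: "coeff_on e4 (n v) C = coeff_on e4 (n v0) C" if "v \<in> J" for v
    using constant_on_interval[OF intervalJ _ that v0, of "\<lambda>v. coeff_on e4 (n v) C"] by blast
  have \<kappa>': "deriv \<kappa> v = 0" if "v \<in> J" for v
  proof (cases "coeff_on e4 (n v0) C = 0")
    case True
    then show ?thesis
      using eqs(4)[OF u0 that u0 that] en_const[OF that] g'_nonzero[OF u0] f_nonzero[OF u0] by simp
  next
    case False
    then have "\<kappa> w = 0" if "w \<in> J" for w
      using \<kappa>en[OF that] en_const[OF that] by simp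
    then show ?thesis
      using deriv_of_const[OF that _ \<kappa>_deriv[OF that]] by blast
  qed
  have \<kappa>: "\<kappa> v = \<kappa> v0" if "v \<in> J" for v
    using constant_on_interval[OF intervalJ _ that v0, of \<kappa>] \<kappa>_deriv \<kappa>' by simp
  have en: "coeff_on e4 (n v) C = 0" if "v \<in> J" for v
    using eqs(4)[OF u0 that u0 that] \<kappa>'[OF that] E(2)[OF u0 that] by simp
  have rn: "coeff_on (r v) (n v) C = 0" if "v \<in> J" for v
    using eqs(3)[OF u0 that u0 that] \<kappa>'[OF that] E(2)[OF u0 that] by simp
  have tn: "coeff_on (t v) (n v) C = \<kappa> v * coeff_on (r v) (t v) C" if "v \<in> J" for v
    using deriv_of_const[OF that rn D(5)[OF that]] by simp
  let ?c = "coeff_on (r v0) (t v0) C"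
  \<comment> \<open>If this component were zero, all components of \<open>C\<close> would be.\<close>
  have "?c \<noteq> 0"
    using bivector_eq_0[OF v0 C(1)] C(2) er et en rn tn v0 by auto
  then have "gauss_system (\<kappa> v0) ?c (\<lambda>u. L (u, v0))"
    unfolding gauss_system_def
    using eqs(1)[OF _ v0 _ v0] eqs(2)[OF _ v0 _ v0] eqs(5)[OF _ v0 _ v0] E(2)[OF _ v0]
      et[OF v0] tn[OF v0] by auto
  then show ?thesis
    using \<kappa> by blast
qed

text \<open>For constant \<open>\<kappa> = k\<close> the bivector \<open>r \<and> t + k t \<and> n\<close> is constant along the curve, as it is
  the dual in \<open>E3\<close> of the constant pole \<open>n + k r\<close> of the circle.\<close>

lemma gauss_system_imp_second_kind:
  assumes k: "\<And>v. v \<in> J \<Longrightarrow> \<kappa> v = k" and sys: "gauss_system k c l" and l: "smooth_on I l"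
  shows "pointwise_1_type_second_kind (I \<times> J) z X Y"
proof -
  obtain v0 where v0: "v0 \<in> J" using J_nonempty by blast
  let ?C = "\<lambda>v. wedge (r v) (t v) + k *\<^sub>R wedge (t v) (n v)"
  have "(?C has_vector_derivative 0) (at v)" if "v \<in> J" for v
  proof -
    have "(?C has_vector_derivative
        \<kappa> v *\<^sub>R wedge (r v) (n v) + k *\<^sub>R (- wedge (r v) (n v))) (at v)"
      by (rule has_vector_derivative_add[OF wedge_derivs(1)[OF that]
            bounded_linear.has_vector_derivative[OF bounded_linear_scaleR_right wedge_derivs(6)[OF that]]])
    then show ?thesis
      using k[OF that] by simp
  qed
  then have const: "?C v = ?C v0" if "v \<in> J" for v
    using constant_on_interval[OF intervalJ _ that v0, of ?C] by blast
  have \<kappa>': "deriv \<kappa> v = 0" if "v \<in> J" for v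
    using deriv_of_const[OF that k \<kappa>_deriv[OF that]] .
  show ?thesis
    unfolding pointwise_1_type_second_kind_def pointwise_1_type_def
  proof (intro bexI conjI exI ballI)
    show "c *\<^sub>R ?C v0 \<in> bivectors"
      by (intro bivectors_scaleR bivectors_add wedge_in_bivectors)
    have "coeff_on (r v0) (t v0) (c *\<^sub>R ?C v0) = c"
      unfolding coeff_on_simps frame_inner[OF v0] by simp
    moreover have "coeff_on (r v0) (t v0) 0 = 0"
      by (simp add: coeff_on_def)
    ultimately show "c *\<^sub>R ?C v0 \<noteq> 0"
      using sys unfolding gauss_system_def by metis
    show "smooth_on (I \<times> J) (\<lambda>p. l (fst p))"
      by (rule smooth_on_fst[OF openI openJ l])
  next
    fix p assume p: "p \<in> I \<times> J"
    show "l (fst p) \<noteq> 0"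
      using sys p by (auto simp: gauss_system_def)
    obtain u v where uv: "p = (u, v)" "u \<in> I" "v \<in> J" using p by blast
    have s: "f3 u + f1 u / f u * f2 u - f1 u * k\<^sup>2 / (f u)\<^sup>2 = - l u * (f1 u + c)"
      "g3 u + f1 u / f u * g2 u - g1 u * (k\<^sup>2 + 1) / (f u)\<^sup>2 = - l u * g1 u"
      "f1 u * k / (f u)\<^sup>2 = - l u * (k * c)"
      using sys uv(2) by (simp_all add: gauss_system_def)
    show "laplacian z X Y G p = l (fst p) *\<^sub>R (G p + c *\<^sub>R ?C v0)"
      unfolding uv(1) laplacian_gauss_map[OF uv(2,3)] gauss_map_eq[OF uv(2,3)] k[OF uv(3)]
        \<kappa>'[OF uv(3)] s const[OF uv(3), symmetric]
      by (simp add: algebra_simps)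
  qed
qed

section \<open>Curves of nonzero spherical curvature\<close>

text \<open>If \<open>f'\<close> is constant, then \<open>g' g'' = - f' f'' = 0\<close>, so that \<open>g'\<close> is constant as well.\<close>

lemma constant_slope_imp_linear:
  assumes "\<And>u. u \<in> I \<Longrightarrow> f1 u = a"
  shows "\<exists>a1 b b1. linear_meridian I f g a a1 b b1"
proof -
  obtain u0 where u0: "u0 \<in> I" using I_nonempty by blast
  have "f2 u = 0" if "u \<in> I" for u
    using DERIV_cong_open[OF profile_derivs(2)[OF that] DERIV_const that] assms by blast
  then have "g2 u = 0" if "u \<in> I" for u
    using arclength'[OF that] g'_nonzero[OF that] that by simp
  then have "(g1 has_vector_derivative 0) (at u)" if "u \<in> I" for u
    using profile_derivs(5)[OF that] that by (simp add: has_real_derivative_iff_has_vector_derivative)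
  then have "g1 u = g1 u0" if "u \<in> I" for u
    using constant_on_interval[OF intervalI _ that u0, of g1] by blast
  then have "\<exists>b1. \<forall>u\<in>I. g u = g1 u0 * u + b1"
    by (intro linear_on_interval[OF intervalI]) (metis profile_derivs(4))
  moreover have "\<exists>a1. \<forall>u\<in>I. f u = a * u + a1"
    by (intro linear_on_interval[OF intervalI]) (metis profile_derivs(1) assms)
  ultimately show ?thesis
    unfolding linear_meridian_def by blast
qed

lemma linear_meridian_derivs:
  assumes lin: "linear_meridian I f g a a1 b b1" and u: "u \<in> I"
  shows "f1 u = a" "g1 u = b" "f2 u = 0" "g2 u = 0" "f3 u = 0" "g3 u = 0"
proof -
  have D: "((\<lambda>s. p * s + q) has_real_derivative p) (at s)" for p q s :: real
    by (auto intro!: derivative_eq_intros)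
  have 1: "f1 u = a" "g1 u = b" if "u \<in> I" for u
    using DERIV_cong_open[OF profile_derivs(1)[OF that] D that, of a a1]
      DERIV_cong_open[OF profile_derivs(4)[OF that] D that, of b b1] lin
    by (auto simp: linear_meridian_def)
  have 2: "f2 u = 0" "g2 u = 0" if "u \<in> I" for u
    using DERIV_cong_open[OF profile_derivs(2)[OF that] DERIV_const that, of a]
      DERIV_cong_open[OF profile_derivs(5)[OF that] DERIV_const that, of b] 1 by auto
  have 3: "f3 u = 0" "g3 u = 0" if "u \<in> I" for u
    using DERIV_cong_open[OF profile_derivs(3)[OF that] DERIV_const that, of 0]
      DERIV_cong_open[OF profile_derivs(6)[OF that] DERIV_const that, of 0] 2 by auto
  show "f1 u = a" "g1 u = b" "f2 u = 0" "g2 u = 0" "f3 u = 0" "g3 u = 0"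
    using 1 2 3 u by auto
qed

text \<open>The equation at \<open>t \<and> n\<close> reads \<open>l f\<^sup>2 c = - f'\<close> after division by \<open>k\<close>.  The other two equations
  are then combined in two ways.  Their Wronskian combination says that \<open>A = f (f' g'' - g' f'')\<close>,
  which is \<open>f\<close> times the curvature of the meridian, is constant.  Their combination with weights
  \<open>f'\<close> and \<open>g'\<close> gives \<open>l f\<^sup>2 = A\<^sup>2 + k\<^sup>2 + 1\<close>.  Hence \<open>f' = - (A\<^sup>2 + k\<^sup>2 + 1) c\<close> is a nonzero constant.\<close>

lemma gauss_system_imp_linear:
  assumes sys: "gauss_system k c l" and k: "k \<noteq> 0"
  shows "\<exists>a a1 b b1. a \<noteq> 0 \<and> linear_meridian I f g a a1 b b1"
proof -
  obtain u0 where u0: "u0 \<in> I" using I_nonempty by blast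
  define A where "A = (\<lambda>u. f u * (f1 u * g2 u - g1 u * f2 u))"
  have eqs: "(f u)\<^sup>2 * f3 u = - f u * f1 u * f2 u + f1 u * k\<^sup>2 - (l u * (f u)\<^sup>2) * (f1 u + c)"
    "(f u)\<^sup>2 * g3 u = - f u * f1 u * g2 u + g1 u * (k\<^sup>2 + 1) - (l u * (f u)\<^sup>2) * g1 u"
    "(l u * (f u)\<^sup>2) * c = - f1 u" if "u \<in> I" for u
  proof -
    have fu: "f u \<noteq> 0" by (rule f_nonzero[OF that])
    have s: "f3 u + f1 u / f u * f2 u - f1 u * k\<^sup>2 / (f u)\<^sup>2 = - l u * (f1 u + c)"
      "g3 u + f1 u / f u * g2 u - g1 u * (k\<^sup>2 + 1) / (f u)\<^sup>2 = - l u * g1 u"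
      "f1 u * k / (f u)\<^sup>2 = - l u * (k * c)"
      using sys that by (simp_all add: gauss_system_def)
    have "(f u)\<^sup>2 * f3 u + f u * f1 u * f2 u - f1 u * k\<^sup>2
        = (f u)\<^sup>2 * (f3 u + f1 u / f u * f2 u - f1 u * k\<^sup>2 / (f u)\<^sup>2)"
      using fu by (simp add: field_simps power2_eq_square)
    then show "(f u)\<^sup>2 * f3 u = - f u * f1 u * f2 u + f1 u * k\<^sup>2 - (l u * (f u)\<^sup>2) * (f1 u + c)"
      unfolding s by (simp add: algebra_simps)
    have "(f u)\<^sup>2 * g3 u + f u * f1 u * g2 u - g1 u * (k\<^sup>2 + 1)
        = (f u)\<^sup>2 * (g3 u + f1 u / f u * g2 u - g1 u * (k\<^sup>2 + 1) / (f u)\<^sup>2)"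
      using fu by (simp add: field_simps power2_eq_square)
    then show "(f u)\<^sup>2 * g3 u = - f u * f1 u * g2 u + g1 u * (k\<^sup>2 + 1) - (l u * (f u)\<^sup>2) * g1 u"
      unfolding s by (simp add: algebra_simps)
    have "f1 u * k = (- l u * (k * c)) * (f u)\<^sup>2"
      using s(3) fu by (simp add: field_simps)
    then have "k * (l u * (f u)\<^sup>2 * c + f1 u) = 0"
      by (simp add: algebra_simps)
    then show "(l u * (f u)\<^sup>2) * c = - f1 u"
      using k by simp
  qed
  have "(A has_vector_derivative 0) (at u)" if "u \<in> I" for u
  proof -
    have "(A has_real_derivative
        f1 u * (f1 u * g2 u - g1 u * f2 u) + f u * (f1 u * g3 u - g1 u * f3 u)) (at u)"
      unfolding A_def using profile_derivs[OF that]
      by (auto intro!: derivative_eq_intros simp: algebra_simps)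
    moreover have "f u * (f1 u * (f1 u * g2 u - g1 u * f2 u) + f u * (f1 u * g3 u - g1 u * f3 u)) = 0"
      using eqs[OF that] by algebra
    ultimately show ?thesis
      using f_nonzero[OF that] by (simp add: has_real_derivative_iff_has_vector_derivative)
  qed
  then have A: "A u = A u0" if "u \<in> I" for u
    using constant_on_interval[OF intervalI _ that u0, of A] by blast
  have slope: "f1 u = - ((A u0)\<^sup>2 + k\<^sup>2 + 1) * c" if "u \<in> I" for u
  proof -
    have "l u * (f u)\<^sup>2 = (A u)\<^sup>2 + k\<^sup>2 + 1"
      using eqs[OF that] arclength[OF that] arclength'[OF that] arclength''[OF that]
      unfolding A_def by algebra
    then show ?thesis
      using eqs(3)[OF that] A[OF that] by algebra
  qed
  have "(A u0)\<^sup>2 + k\<^sup>2 + 1 > 0"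
    by (simp add: add_nonneg_pos)
  then have "- ((A u0)\<^sup>2 + k\<^sup>2 + 1) * c \<noteq> 0"
    using sys by (auto simp: gauss_system_def)
  then show ?thesis
    using constant_slope_imp_linear[OF slope] by blast
qed

text \<open>For a line all second derivatives vanish and the system can be solved for \<open>l\<close> and \<open>c\<close>; the
  condition \<open>a \<noteq> 0\<close> is what makes \<open>c\<close>, and so \<open>C\<close>, nonzero.\<close>

lemma linear_imp_second_kind:
  assumes k: "\<And>v. v \<in> J \<Longrightarrow> \<kappa> v = k" and a: "a \<noteq> 0" and lin: "linear_meridian I f g a a1 b b1"
  shows "pointwise_1_type_second_kind (I \<times> J) z X Y"
proof (rule gauss_system_imp_second_kind[OF k])
  have "k\<^sup>2 + 1 > 0" by (simp add: add_nonneg_pos)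
  then have k1: "k\<^sup>2 + 1 \<noteq> 0" by simp
  then show "gauss_system k (- a / (k\<^sup>2 + 1)) (\<lambda>u. (k\<^sup>2 + 1) / (f u)\<^sup>2)"
    unfolding gauss_system_def
  proof (intro conjI ballI)
    show "- a / (k\<^sup>2 + 1) \<noteq> 0"
      using a k1 by simp
    fix u assume u: "u \<in> I"
    note d = linear_meridian_derivs[OF lin u] and fu = f_nonzero[OF u]
    have c: "(k\<^sup>2 + 1) / (f u)\<^sup>2 * (- a / (k\<^sup>2 + 1)) = - a / (f u)\<^sup>2"
      using k1 by simp
    show "(k\<^sup>2 + 1) / (f u)\<^sup>2 \<noteq> 0"
      using k1 fu by simp
    show "f3 u + f1 u / f u * f2 u - f1 u * k\<^sup>2 / (f u)\<^sup>2
        = - ((k\<^sup>2 + 1) / (f u)\<^sup>2) * (f1 u + - a / (k\<^sup>2 + 1))"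
      unfolding d ring_distribs mult_minus_left c by (simp add: add_divide_distrib algebra_simps)
    show "g3 u + f1 u / f u * g2 u - g1 u * (k\<^sup>2 + 1) / (f u)\<^sup>2 = - ((k\<^sup>2 + 1) / (f u)\<^sup>2) * g1 u"
      by (simp add: d)
    show "f1 u * k / (f u)\<^sup>2 = - ((k\<^sup>2 + 1) / (f u)\<^sup>2) * (k * (- a / (k\<^sup>2 + 1)))"
      using arg_cong[OF c, of "\<lambda>x. - k * x"] k1 by (simp add: d mult_ac)
  qed
  have "smooth_on I (\<lambda>u. (f u)\<^sup>2)"
    using smooth_on_mult[OF openI smooth_f smooth_f] by (simp add: power2_eq_square)
  then show "smooth_on I (\<lambda>u. (k\<^sup>2 + 1) / (f u)\<^sup>2)"
    by (rule smooth_on_divide[OF openI smooth_on_const]) (simp add: f_nonzero)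
qed

end

section \<open>Great circles and the differential equation of the meridian\<close>

context meridian
begin

lemma slope_bound: "u \<in> I \<Longrightarrow> 1 - (f1 u)\<^sup>2 = (g1 u)\<^sup>2"
  and slope_positive: "u \<in> I \<Longrightarrow> 1 - (f1 u)\<^sup>2 > 0"
proof -
  assume u: "u \<in> I"
  show "1 - (f1 u)\<^sup>2 = (g1 u)\<^sup>2"
    using arclength[OF u] by simp
  then show "1 - (f1 u)\<^sup>2 > 0"
    using g'_nonzero[OF u] by simp
qed

text \<open>A continuous function without zeros has one sign on an interval.\<close>

lemma g1_sign: "\<exists>\<sigma>\<in>{1, -1}. \<forall>u\<in>I. g1 u = \<sigma> * sqrt (1 - (f1 u)\<^sup>2)"
proof -
  have "continuous_on I g1"
    using profile_derivs(5) by (auto intro!: continuous_at_imp_continuous_on DERIV_isCont)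
  then have interval: "is_interval (g1 ` I)"
    using intervalI by (metis connected_continuous_image is_interval_connected_1)
  have same: False if "u \<in> I" "w \<in> I" "g1 u < 0" "g1 w > 0" for u w
    using mem_is_interval_1_I[OF interval, of "g1 u" "g1 w" 0] that g'_nonzero by force
  have sqrt: "sqrt (1 - (f1 u)\<^sup>2) = \<bar>g1 u\<bar>" if "u \<in> I" for u
    using slope_bound[OF that] by simp
  show ?thesis
  proof (cases "\<exists>u\<in>I. g1 u < 0")
    case True
    then have "g1 w < 0" if "w \<in> I" for w
      using same that g'_nonzero[OF that] by force
    then show ?thesis
      using sqrt by (intro bexI[of _ "-1"]) (auto simp: abs_of_neg)
  next
    case False
    then show ?thesis
      using sqrt by (intro bexI[of _ 1]) force+
  qed
qed

text \<open>\<open>P\<close> and \<open>Q\<close> are the left-hand sides of the first two equations of the system for \<open>k = 0\<close>,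
  up to sign the components of \<open>\<Delta>G\<close> at \<open>r \<and> t\<close> and \<open>e4 \<and> t\<close> over a great circle.\<close>

definition P :: "real \<Rightarrow> real" where
  "P u = f3 u + f1 u / f u * f2 u"

definition Q :: "real \<Rightarrow> real" where
  "Q u = g3 u + f1 u / f u * g2 u - g1 u / (f u)\<^sup>2"

lemma gauss_system_great:
  "gauss_system 0 c l \<longleftrightarrow>
    c \<noteq> 0 \<and> (\<forall>u\<in>I. l u \<noteq> 0 \<and> P u = - l u * (f1 u + c) \<and> Q u = - l u * g1 u)"
  by (simp add: gauss_system_def P_def Q_def)

lemma smooth_P: "smooth_on I P" and smooth_Q: "smooth_on I Q"
proof -
  have h: "smooth_on I (\<lambda>u. f1 u / f u)"
    by (rule smooth_on_divide[OF openI smooth_f1 smooth_f f_nonzero])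
  show "smooth_on I P"
    unfolding P_def[abs_def]
    by (rule smooth_on_add[OF openI smooth_on_deriv(1)[OF smooth_f2 openI]
          smooth_on_mult[OF openI h smooth_f2]])
  have "smooth_on I (\<lambda>u. (f u)\<^sup>2)"
    using smooth_on_mult[OF openI smooth_f smooth_f] by (simp add: power2_eq_square)
  then have "smooth_on I (\<lambda>u. g1 u / (f u)\<^sup>2)"
    by (rule smooth_on_divide[OF openI smooth_g1]) (simp add: f_nonzero)
  then show "smooth_on I Q"
    unfolding Q_def[abs_def]
    by (rule smooth_on_diff[OF openI smooth_on_add[OF openI smooth_on_deriv(1)[OF smooth_g2 openI]
            smooth_on_mult[OF openI h smooth_g2]]])
qed

text \<open>The numerator and the denominator of the differential equation are obtained from \<open>P\<close> and \<open>Q\<close>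
  by eliminating \<open>g\<close> with the help of \<open>f'\<^sup>2 + g'\<^sup>2 = 1\<close> and its first two derivatives.\<close>

lemma ode_terms:
  assumes u: "u \<in> I"
  shows "ode_den f u = - (f u)\<^sup>2 * (g1 u)^3 * Q u"
    and "ode_num f u = sqrt (1 - (f1 u)\<^sup>2) * ((f u)\<^sup>2 * (g1 u)^3 * (f1 u * Q u - g1 u * P u))"
proof -
  have F: "deriv (\<lambda>s. f s * f2 s) u = f1 u * f2 u + f u * f3 u"
    using profile_derivs[OF u] by (intro DERIV_imp_deriv) (auto intro!: derivative_eq_intros)
  have fP: "(f u)\<^sup>2 * P u = (f u)\<^sup>2 * f3 u + f u * f1 u * f2 u"
    and fQ: "(f u)\<^sup>2 * Q u = (f u)\<^sup>2 * g3 u + f u * f1 u * g2 u - g1 u"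
    using f_nonzero[OF u] by (simp_all add: P_def Q_def field_simps power2_eq_square)
  note facts = fP fQ arclength[OF u] arclength'[OF u] arclength''[OF u]
  show "ode_den f u = - (f u)\<^sup>2 * (g1 u)^3 * Q u"
    unfolding ode_den_def Let_def F using facts by algebra
  have "- (f u * (1 - (f1 u)\<^sup>2) * (f1 u * f2 u + f u * f3 u) + (f u)\<^sup>2 * f1 u * (f2 u)\<^sup>2
      + f1 u * (1 - (f1 u)\<^sup>2)\<^sup>2) = (f u)\<^sup>2 * (g1 u)^3 * (f1 u * Q u - g1 u * P u)"
    using facts by algebra
  then show "ode_num f u = sqrt (1 - (f1 u)\<^sup>2) * ((f u)\<^sup>2 * (g1 u)^3 * (f1 u * Q u - g1 u * P u))"
    unfolding ode_num_def Let_def F by (metis minus_mult_commute)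
qed

lemma ode_den_eq_0_iff: "u \<in> I \<Longrightarrow> ode_den f u = 0 \<longleftrightarrow> Q u = 0"
  using ode_terms(1) f_nonzero g'_nonzero by simp

text \<open>The second factor is the value that the system for \<open>k = 0\<close> assigns to \<open>c\<close> when \<open>l\<close> is
  eliminated.  Thus the quotient divided by \<open>sqrt (1 - f'\<^sup>2)\<close> has to be constant, and the logarithmic
  derivative of that square root is the right-hand side of the differential equation.\<close>

lemma ode_quotient:
  assumes u: "u \<in> I" and Q: "Q u \<noteq> 0"
  shows "ode_num f u / ode_den f u = sqrt (1 - (f1 u)\<^sup>2) * (g1 u * P u / Q u - f1 u)"
  unfolding ode_terms[OF u] using f_nonzero[OF u] g'_nonzero[OF u] Q by (simp add: field_simps)

lemma ln_sqrt_deriv: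
  assumes u: "u \<in> I"
  shows "((\<lambda>s. ln (sqrt (1 - (f1 s)\<^sup>2))) has_real_derivative - (f1 u * f2 u) / (1 - (f1 u)\<^sup>2)) (at u)"
proof -
  have "((\<lambda>s. ln (sqrt (1 - (f1 s)\<^sup>2))) has_real_derivative
      1 / sqrt (1 - (f1 u)\<^sup>2) * (inverse (sqrt (1 - (f1 u)\<^sup>2)) / 2 * (- (2 * f1 u * f2 u)))) (at u)"
    using slope_positive[OF u] profile_derivs[OF u] by (auto intro!: derivative_eq_intros)
  also have "1 / sqrt (1 - (f1 u)\<^sup>2) * (inverse (sqrt (1 - (f1 u)\<^sup>2)) / 2 * (- (2 * f1 u * f2 u)))
      = - (f1 u * f2 u) / (sqrt (1 - (f1 u)\<^sup>2) * sqrt (1 - (f1 u)\<^sup>2))"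
    by (simp add: field_simps)
  also have "sqrt (1 - (f1 u)\<^sup>2) * sqrt (1 - (f1 u)\<^sup>2) = 1 - (f1 u)\<^sup>2"
    using slope_positive[OF u] by simp
  finally show ?thesis .
qed

lemma gauss_system_imp_ode:
  assumes sys: "gauss_system 0 c l"
  shows "ode_solution I f"
  unfolding ode_solution_def
proof (intro ballI conjI)
  have c: "c \<noteq> 0" and s: "l u \<noteq> 0" "P u = - l u * (f1 u + c)" "Q u = - l u * g1 u" if "u \<in> I" for u
    using sys that by (auto simp: gauss_system_great)
  have quot: "ode_num f u / ode_den f u = sqrt (1 - (f1 u)\<^sup>2) * c" and Q: "Q u \<noteq> 0" if "u \<in> I" for u
  proof -
    show Q: "Q u \<noteq> 0"
      using s[OF that] g'_nonzero[OF that] by simp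
    have "g1 u * P u / Q u - f1 u = c"
      using s[OF that] g'_nonzero[OF that] by simp
    then show "ode_num f u / ode_den f u = sqrt (1 - (f1 u)\<^sup>2) * c"
      using ode_quotient[OF that Q] by simp
  qed
  fix u assume u: "u \<in> I"
  show "ode_den f u \<noteq> 0"
    using Q[OF u] ode_den_eq_0_iff[OF u] by simp
  show "ode_num f u / ode_den f u \<noteq> 0"
    using quot[OF u] c[OF u] slope_positive[OF u] by simp
  have "((\<lambda>s. ln (sqrt (1 - (f1 s)\<^sup>2)) + ln \<bar>c\<bar>) has_real_derivative
      - (f1 u * f2 u) / (1 - (f1 u)\<^sup>2) + 0) (at u)"
    by (rule DERIV_add[OF ln_sqrt_deriv[OF u] DERIV_const])
  then have "((\<lambda>s. ln (sqrt (1 - (f1 s)\<^sup>2)) + ln \<bar>c\<bar>) has_real_derivative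
      - (f1 u * f2 u) / (1 - (f1 u)\<^sup>2)) (at u)" by simp
  then show "((\<lambda>s. ln \<bar>ode_num f s / ode_den f s\<bar>) has_real_derivative
      - (f1 u * f2 u) / (1 - (f1 u)\<^sup>2)) (at u)"
  proof (rule has_field_derivative_transform_within_open[OF _ openI u])
    fix w assume w: "w \<in> I"
    show "ln (sqrt (1 - (f1 w)\<^sup>2)) + ln \<bar>c\<bar> = ln \<bar>ode_num f w / ode_den f w\<bar>"
      using quot[OF w] slope_positive[OF w] c[OF w] by (simp add: abs_mult ln_mult)
  qed
qed

text \<open>The differential equation only makes the absolute value of \<open>c\<close> constant; \<open>c\<close> itself is then
  constant because it is differentiable and has no zeros.\<close>

lemma ode_imp_gauss_system:
  assumes ode: "ode_solution I f"
  shows "\<exists>c l. gauss_system 0 c l \<and> smooth_on I l"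
proof -
  obtain u0 where u0: "u0 \<in> I" using I_nonempty by blast
  have Q: "Q u \<noteq> 0" if "u \<in> I" for u
    using ode that ode_den_eq_0_iff[OF that] by (auto simp: ode_solution_def)
  define c where "c = (\<lambda>u. g1 u * P u / Q u - f1 u)"
  have quot: "ode_num f u / ode_den f u = sqrt (1 - (f1 u)\<^sup>2) * c u" if "u \<in> I" for u
    using ode_quotient[OF that Q[OF that]] by (simp add: c_def)
  have c0: "c u \<noteq> 0" if "u \<in> I" for u
    using ode that quot[OF that] by (auto simp: ode_solution_def)
  have "((\<lambda>s. ln \<bar>ode_num f s / ode_den f s\<bar> - ln (sqrt (1 - (f1 s)\<^sup>2))) has_real_derivative 0) (at u)"
    if "u \<in> I" for u
  proof -
    have "((\<lambda>s. ln \<bar>ode_num f s / ode_den f s\<bar>) has_real_derivative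
        - (f1 u * f2 u) / (1 - (f1 u)\<^sup>2)) (at u)"
      using ode that by (auto simp: ode_solution_def)
    from DERIV_diff[OF this ln_sqrt_deriv[OF that]] show ?thesis by simp
  qed
  moreover have "ln \<bar>ode_num f u / ode_den f u\<bar> - ln (sqrt (1 - (f1 u)\<^sup>2)) = ln \<bar>c u\<bar>" if "u \<in> I" for u
    using quot[OF that] slope_positive[OF that] c0[OF that] by (simp add: abs_mult ln_mult)
  ultimately have "ln \<bar>c u\<bar> = ln \<bar>c u0\<bar>" if "u \<in> I" for u
    using constant_on_interval[OF intervalI _ that u0,
        of "\<lambda>s. ln \<bar>ode_num f s / ode_den f s\<bar> - ln (sqrt (1 - (f1 s)\<^sup>2))"] that u0
    by (simp add: has_real_derivative_iff_has_vector_derivative)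
  then have "\<bar>c u\<bar> = \<bar>c u0\<bar>" if "u \<in> I" for u
    using c0[OF that] c0[OF u0] that by (metis ln_inj_iff zero_less_abs_iff)
  \<comment> \<open>Squares are differentiable, unlike absolute values.\<close>
  then have sq: "(c u)\<^sup>2 = (c u0)\<^sup>2" if "u \<in> I" for u
    using that by (metis power2_abs)
  have smooth_c: "smooth_on I c"
    unfolding c_def
    by (rule smooth_on_diff[OF openI smooth_on_divide[OF openI
            smooth_on_mult[OF openI smooth_g1 smooth_P] smooth_Q Q] smooth_f1])
  have "(c has_vector_derivative 0) (at u)" if "u \<in> I" for u
  proof -
    note D = smooth_on_deriv(2)[OF smooth_c openI that]
    have "((\<lambda>s. (c s)\<^sup>2) has_real_derivative 2 * c u * deriv c u) (at u)"
      using D by (auto intro!: derivative_eq_intros)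
    from DERIV_cong_open[OF this DERIV_const that] sq have "2 * c u * deriv c u = 0" by blast
    then show ?thesis
      using D c0[OF that] by (simp add: has_real_derivative_iff_has_vector_derivative)
  qed
  then have c: "c u = c u0" if "u \<in> I" for u
    using constant_on_interval[OF intervalI _ that u0, of c] by blast
  have "gauss_system 0 (c u0) (\<lambda>u. (-1 * Q u) / g1 u)"
    unfolding gauss_system_great
  proof (intro conjI ballI)
    show "c u0 \<noteq> 0" by (rule c0[OF u0])
    fix u assume u: "u \<in> I"
    note nz = Q[OF u] g'_nonzero[OF u]
    show "(-1 * Q u) / g1 u \<noteq> 0" using nz by simp
    show "Q u = - ((-1 * Q u) / g1 u) * g1 u" using nz by simp
    have "f1 u + c u0 = g1 u * P u / Q u"
      using c[OF u] by (simp add: c_def)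
    then show "P u = - ((-1 * Q u) / g1 u) * (f1 u + c u0)"
      using nz by simp
  qed
  moreover have "smooth_on I (\<lambda>u. (-1 * Q u) / g1 u)"
    by (rule smooth_on_divide[OF openI smooth_on_mult[OF openI smooth_on_const smooth_Q] smooth_g1
          g'_nonzero])
  ultimately show ?thesis by blast
qed

section \<open>The classification\<close>

lemma second_kind_iff:
  "pointwise_1_type_second_kind (I \<times> J) z X Y \<longleftrightarrow>
    (is_circle J r \<and> (\<exists>a a1 b b1. a \<noteq> 0 \<and> linear_meridian I f g a a1 b b1)) \<or>
    (is_great_circle J r \<and> ode_meridian I f g)"
proof
  assume "pointwise_1_type_second_kind (I \<times> J) z X Y"
  then obtain k c l where k: "\<forall>v\<in>J. \<kappa> v = k" and sys: "gauss_system k c l"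
    using second_kind_imp_gauss_system by blast
  show "(is_circle J r \<and> (\<exists>a a1 b b1. a \<noteq> 0 \<and> linear_meridian I f g a a1 b b1)) \<or>
    (is_great_circle J r \<and> ode_meridian I f g)"
  proof (cases "k = 0")
    case True
    then show ?thesis
      using k sys gauss_system_imp_ode g1_sign by (auto simp: is_great_circle_iff ode_meridian_def)
  next
    case False
    then show ?thesis
      using k gauss_system_imp_linear[OF sys] is_circle_iff by blast
  qed
next
  assume "(is_circle J r \<and> (\<exists>a a1 b b1. a \<noteq> 0 \<and> linear_meridian I f g a a1 b b1)) \<or>
    (is_great_circle J r \<and> ode_meridian I f g)"
  then show "pointwise_1_type_second_kind (I \<times> J) z X Y"
  proof (elim disjE conjE exE)
    fix a a1 b b1
    assume "is_circle J r" "a \<noteq> 0" "linear_meridian I f g a a1 b b1"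
    then show ?thesis
      using linear_imp_second_kind is_circle_iff by blast
  next
    assume "is_great_circle J r" "ode_meridian I f g"
    then show ?thesis
      using ode_imp_gauss_system gauss_system_imp_second_kind
      unfolding is_great_circle_iff ode_meridian_def by blast
  qed
qed

section \<open>Geometry of the surfaces over circles with linear meridian\<close>

lemma linear_developable:
  assumes lin: "linear_meridian I f g a a1 b b1"
  shows "developable_ruled_surface I J z X Y"
  unfolding developable_ruled_surface_def ruled_surface_def
proof (intro conjI exI ballI)
  show "smooth_on J (\<lambda>v. a1 *\<^sub>R r v + b1 *\<^sub>R e4)" "smooth_on J (\<lambda>v. a *\<^sub>R r v + b *\<^sub>R e4)"
    by (rule smooth_on_add[OF openJ smooth_on_scaleR[OF openJ smooth_on_const smooth_r] smooth_on_const])+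
  show "a *\<^sub>R r v + b *\<^sub>R e4 \<noteq> 0" if v: "v \<in> J" for v
  proof
    assume "a *\<^sub>R r v + b *\<^sub>R e4 = 0"
    then have "(a *\<^sub>R r v + b *\<^sub>R e4) \<bullet> e4 = 0" by simp
    then have "b = 0"
      by (simp add: inner_add_left frame_inner[OF v])
    then show False
      using I_nonempty linear_meridian_derivs(2)[OF lin] g'_nonzero by auto
  qed
  show "z (u, v) = (a1 *\<^sub>R r v + b1 *\<^sub>R e4) + u *\<^sub>R (a *\<^sub>R r v + b *\<^sub>R e4)" if "u \<in> I" "v \<in> J" for u v
    using lin that by (simp add: meridian_surface_def linear_meridian_def algebra_simps)
  show "gauss_curvature z X Y p = 0" if "p \<in> I \<times> J" for p
    using that gauss_curvature_eq linear_meridian_derivs(3)[OF lin] by auto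
qed

text \<open>On the surface, both \<open>p \<bullet> z = h (a u + a1)\<close> and \<open>e4 \<bullet> z = b u + b1\<close> are affine functions of
  \<open>u\<close>.  Eliminating \<open>u\<close> gives the equation of a hyperplane; its normal is not zero because
  \<open>b \<noteq> 0\<close> and \<open>p \<noteq> 0\<close> lies in \<open>E3\<close>.\<close>

lemma linear_over_circle_in_3_space:
  assumes lin: "linear_meridian I f g a a1 b b1" and circle: "is_circle J r"
  shows "lies_in_3_space (z ` (I \<times> J))"
proof -
  obtain p h where p: "p \<in> E3" "p \<noteq> 0" "r ` J \<subseteq> {x \<in> S2. p \<bullet> x = h}"
    using circle unfolding is_circle_def by blast
  obtain u0 where "u0 \<in> I" using I_nonempty by blast
  then have b: "b \<noteq> 0"
    using linear_meridian_derivs(2)[OF lin] g'_nonzero by metis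
  let ?q = "b *\<^sub>R p - (a * h) *\<^sub>R e4" and ?d = "b * a1 * h - a * h * b1"
  have "?q \<noteq> 0"
  proof
    assume q: "?q = 0"
    then have "?q \<bullet> p = 0" by simp
    moreover have "e4 \<bullet> p = 0" using p(1) by (simp add: E3_iff inner_axis')
    ultimately show False
      using p(2) b by (simp add: inner_diff_left)
  qed
  then have "affine {x. ?q \<bullet> x = ?d}" "aff_dim {x. ?q \<bullet> x = ?d} = 3"
    by (simp_all add: affine_hyperplane aff_dim_hyperplane)
  moreover have "z ` (I \<times> J) \<subseteq> {x. ?q \<bullet> x = ?d}"
  proof clarify
    fix u v assume uv: "u \<in> I" "v \<in> J"
    have "p \<bullet> r v = h" "p \<bullet> e4 = 0"
      using p uv(2) by (auto simp: E3_iff inner_axis)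
    then show "?q \<bullet> z (u, v) = ?d"
      using lin uv(1) frame_inner[OF uv(2)]
      by (simp add: meridian_surface_def linear_meridian_def inner_add_right inner_diff_left
          algebra_simps)
  qed
  ultimately show ?thesis
    unfolding lies_in_3_space_def by blast
qed

end

theorem theorem3p5:
  fixes I J :: "real set" and f g :: "real \<Rightarrow> real" and r :: "real \<Rightarrow> real^4"
  assumes "meridian_data I J f g r"
    and "\<forall>u\<in>I. deriv g u \<noteq> 0"
  shows "(pointwise_1_type_second_kind (I \<times> J)
            (meridian_surface f g r) (frame_x f g r) (frame_y f g r) \<longleftrightarrow>
          (is_circle J r \<and> (\<exists>a a1 b b1. a \<noteq> 0 \<and> linear_meridian I f g a a1 b b1)) \<or>
          (is_great_circle J r \<and> ode_meridian I f g)) \<and>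
         (is_circle J r \<and> (\<exists>a a1 b b1. linear_meridian I f g a a1 b b1) \<longrightarrow>
          developable_ruled_surface I J
            (meridian_surface f g r) (frame_x f g r) (frame_y f g r) \<and>
          lies_in_3_space (meridian_surface f g r ` (I \<times> J)))"
proof -
  interpret meridian I J f g r
    using assms by unfold_locales auto
  show ?thesis
    using second_kind_iff linear_developable linear_over_circle_in_3_space by blast
qed

end
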